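(* Let $K_3$ be the triangle (the complete undirected graph on three vertices without loops). Then $\mathrm{CSP}(K_3)$ is not Datalog$^\cup$-reducible to $\mathrm{CSP}(\mathbf{OR}_{\mathrm{T}}[\mathbb{Z}_2^{[3]},\mathbb{Z}_3^{[3]}])$.
   Context: All structures are finite relational structures. $\mathrm{CSP}(\mathbf{A})$ is the class of finite structures over the vocabulary of $\mathbf{A}$ that admit a homomorphism to $\mathbf{A}$; any finite structure over that vocabulary is an instance. For a finite group $\Gamma$ and $r\ge1$, $\Gamma^{[r]}$ is the structure with universe $\Gamma$ and one $r$-ary relation for each right coset $\Delta\delta$ of each subgroup $\Delta\leq\Gamma^r$. Tractable or-construction: for nonempty $\tau_i$-structures $\mathbf{A}_i$ ($i=1,2$) with disjoint vocabularies and disjoint universes, fresh elements $c_1,c_2$ and a fresh binary symbol $S$, $\mathbf{OR}_{\mathrm{T}}[\mathbf{A}_1,\mathbf{A}_2]$ is the structure over $\tau_1\cup\tau_2\cup\{S\}$ with universe $A_1\cup A_2\cup\{c_1,c_2\}$, with $R$ interpreted as $R^{\mathbf{A}_i}\cup\{(c_i,\dots,c_i)\}$ for $R\in\tau_i$, and $S$ interpreted as $(A_1\times\{c_2\})\cup(\{c_1\}\times A_2)$. Datalog$^\cup$-reductions: Structures may be many-sorted (finitely many sorts with disjoint domains; each relation symbol has a sequence of sorts as its arity); ordinary structures have one sort. A Datalog program is a finite set of rules $P_0(\bar x_0)\leftarrow P_1(\bar x_1),\dots,P_m(\bar x_m)$, where $P_0$ is an intensional (defined) predicate, the $P_j$ with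 $j\ge1$ are relation symbols of the input vocabulary or intensional predicates (no negation, no inequality), with a designated output predicate, evaluated by its least fixed point. A (congruence-free) Datalog interpretation $\phi$ from $\sigma$-structures to many-sorted $\tau'$-structures consists of a Datalog program $\phi_t$ for each sort $t$ of $\tau'$, whose output on $\mathbf{B}$ is a set of tuples of elements of $\mathbf{B}$ of some fixed length $d_t$ and fixed sorts, and a Datalog program $\phi_R$ for each symbol $R\in\tau'$ of arity $(t_1,\dots,t_r)$ whose output has length $d_{t_1}+\dots+d_{t_r}$; the structure $\phi(\mathbf{B})$ has as domain of sort $t$ (a copy of) the output of $\phi_t$ on $\mathbf{B}$, and $R^{\phi(\mathbf{B})}$ consists of the tuples $(\bar a_1,\dots,\bar a_r)$ of domain elements of the respective sorts whose concatenation is in the output of $\phi_R$. A union gadget from vocabulary $\tau'$ to vocabulary $\tau$ is given by a map $d$ from the sorts of $\tau'$ to the sorts of $\tau$ and a map $\rho$ from the symbols of $\tau'$ to the symbols of $\tau$ such that the arity of $\rho(R)$ is the image under $d$ of the arity of $R$; it maps $\mathbf{C}$ to the $\tau$-structure whose domain of sort $s$ is the disjoint union of the domains of $\mathbf{C}$ of sorts $t$ with $d(t)=s$, and whose relation $R$ is the union of all $Q^{\mathbf{C}}$ with $\rho(Q)=R$. $\mathrm{CSP}(\mathbf{A}_1)$ is Datalog$^\cup$-reducible to $\mathrm{CSP}(\mathbf{A}_2)$ if there is a composition $\psi$ of a Datalog interpretation followed by a union gadget, mapping instances of $\mathrm{CSP}(\mathbf{A}_1)$ to instances of $\mathrm{CSP}(\mathbf{A}_2)$,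 such that for all instances $\mathbf{B}$ of $\mathrm{CSP}(\mathbf{A}_1)$: $\mathbf{B}\in\mathrm{CSP}(\mathbf{A}_1)$ iff $\psi(\mathbf{B})\in\mathrm{CSP}(\mathbf{A}_2)$. *)

theory Defs
  imports "HOL-Algebra.Algebra"
begin

section \<open>Finite many-sorted relational structures\<close>

text \<open>Ordinary (one-sorted) vocabularies are the ones with sort type \<^typ>\<open>unit\<close>.\<close>

record ('s, 'r) vocab =
  sorts :: "'s set"
  symbols :: "'r set"
  arity :: "'r \<Rightarrow> 's list"

definition vocabulary :: "('s, 'r) vocab \<Rightarrow> bool" where
  "vocabulary V \<longleftrightarrow> finite (sorts V) \<and> finite (symbols V) \<and>
     (\<forall>R\<in>symbols V. set (arity V R) \<subseteq> sorts V)"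

record ('s, 'r, 'a) relstruct =
  sort_dom :: "'s \<Rightarrow> 'a set"
  interp :: "'r \<Rightarrow> 'a list set"

definition finite_structure :: "('s, 'r) vocab \<Rightarrow> ('s, 'r, 'a) relstruct \<Rightarrow> bool" where
  "finite_structure V B \<longleftrightarrow> vocabulary V \<and>
     (\<forall>s\<in>sorts V. finite (sort_dom B s)) \<and>
     (\<forall>s\<in>sorts V. \<forall>t\<in>sorts V. s \<noteq> t \<longrightarrow> sort_dom B s \<inter> sort_dom B t = {}) \<and>
     (\<forall>R\<in>symbols V. \<forall>xs\<in>interp B R. list_all2 (\<lambda>x s. x \<in> sort_dom B s) xs (arity V R))"

text \<open>Since the sorts have disjoint domains, one function represents the whole
  sort-indexed family of maps.\<close>

definition homomorphism ::
    "('s, 'r) vocab \<Rightarrow> ('a \<Rightarrow> 'b) \<Rightarrow> ('s, 'r, 'a) relstruct \<Rightarrow> ('s, 'r, 'b) relstruct \<Rightarrow> bool" where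
  "homomorphism V h B A \<longleftrightarrow>
     (\<forall>s\<in>sorts V. h ` sort_dom B s \<subseteq> sort_dom A s) \<and>
     (\<forall>R\<in>symbols V. \<forall>xs\<in>interp B R. map h xs \<in> interp A R)"

definition CSP :: "('s, 'r) vocab \<Rightarrow> ('s, 'r, 'b) relstruct \<Rightarrow> ('s, 'r, 'a) relstruct set" where
  "CSP V A = {B. finite_structure V B \<and> (\<exists>h. homomorphism V h B A)}"

section \<open>Templates\<close>

datatype edge = Edge

definition graph_vocab :: "(unit, edge) vocab" where
  "graph_vocab = \<lparr>sorts = UNIV, symbols = UNIV, arity = (\<lambda>_. [(), ()])\<rparr>"

definition K3 :: "(unit, edge, nat) relstruct" where
  "K3 = \<lparr>sort_dom = (\<lambda>_. {0, 1, 2}),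
         interp = (\<lambda>_. {[u, v] |u v. u \<in> {0, 1, 2} \<and> v \<in> {0, 1, 2} \<and> u \<noteq> v})\<rparr>"

definition group_power :: "('g, 'm) monoid_scheme \<Rightarrow> nat \<Rightarrow> (nat \<Rightarrow> 'g) monoid" where
  "group_power G r = product_group {..<r} (\<lambda>_. G)"

text \<open>The relation symbols are the cosets themselves: a coset, as a set, determines the
  subgroup it is a right coset of.\<close>

definition coset_vocab :: "('g, 'm) monoid_scheme \<Rightarrow> nat \<Rightarrow> (unit, (nat \<Rightarrow> 'g) set) vocab" where
  "coset_vocab G r =
     \<lparr>sorts = UNIV,
      symbols = (\<Union>D\<in>{D. subgroup D (group_power G r)}. rcosets\<^bsub>group_power G r\<^esub> D),
      arity = (\<lambda>_. replicate r ())\<rparr>"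

definition coset_structure ::
    "('g, 'm) monoid_scheme \<Rightarrow> nat \<Rightarrow> (unit, (nat \<Rightarrow> 'g) set, 'g) relstruct" where
  "coset_structure G r =
     \<lparr>sort_dom = (\<lambda>_. carrier G), interp = (\<lambda>C. (\<lambda>f. map f [0..<r]) ` C)\<rparr>"

text \<open>The constructors make universes and vocabularies disjoint and \<open>C1\<close>, \<open>C2\<close>, \<open>SymS\<close> fresh.\<close>

datatype ('a, 'b) or_elem = ElemL 'a | ElemR 'b | C1 | C2
datatype ('p, 'q) or_symbol = SymL 'p | SymR 'q | SymS

definition OR_T_vocab ::
    "(unit, 'p) vocab \<Rightarrow> (unit, 'q) vocab \<Rightarrow> (unit, ('p, 'q) or_symbol) vocab" where
  "OR_T_vocab V1 V2 =
     \<lparr>sorts = UNIV,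
      symbols = SymL ` symbols V1 \<union> SymR ` symbols V2 \<union> {SymS},
      arity = (\<lambda>R. case R of SymL P \<Rightarrow> arity V1 P | SymR Q \<Rightarrow> arity V2 Q | SymS \<Rightarrow> [(), ()])\<rparr>"

definition OR_T ::
    "(unit, 'p) vocab \<Rightarrow> (unit, 'p, 'a) relstruct \<Rightarrow> (unit, 'q) vocab \<Rightarrow> (unit, 'q, 'b) relstruct \<Rightarrow>
     (unit, ('p, 'q) or_symbol, ('a, 'b) or_elem) relstruct" where
  "OR_T V1 A1 V2 A2 =
     \<lparr>sort_dom = (\<lambda>_. ElemL ` sort_dom A1 () \<union> ElemR ` sort_dom A2 () \<union> {C1, C2}),
      interp = (\<lambda>R. case R of
          SymL P \<Rightarrow> map ElemL ` interp A1 P \<union> {replicate (length (arity V1 P)) C1}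
        | SymR Q \<Rightarrow> map ElemR ` interp A2 Q \<union> {replicate (length (arity V2 Q)) C2}
        | SymS \<Rightarrow> {[ElemL a, C2] |a. a \<in> sort_dom A1 ()} \<union> {[C1, ElemR b] |b. b \<in> sort_dom A2 ()})\<rparr>"

section \<open>Datalog programs\<close>

text \<open>A variable \<open>(s, i)\<close> has sort \<open>s\<close> and ranges over the domain of sort \<open>s\<close>. Bodies may be
  empty and heads may contain variables that do not occur in the body.\<close>

type_synonym 's var = "'s \<times> nat"

datatype ('s, 'r) atom =
    Input 'r (args: "'s var list")
  | Intensional nat (args: "'s var list")

datatype ('s, 'r) rule =
  Rule (head_pred: nat) (head_args: "'s var list") (body: "('s, 'r) atom list")

record ('s, 'r) program =
  rules :: "('s, 'r) rule list"
  idb_arity :: "nat \<Rightarrow> 's list"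
  out_pred :: nat

definition rule_vars :: "('s, 'r) rule \<Rightarrow> 's var set" where
  "rule_vars r = set (head_args r) \<union> (\<Union>a\<in>set (body r). set (args a))"

fun well_sorted_atom :: "('s, 'r) vocab \<Rightarrow> ('s, 'r) program \<Rightarrow> ('s, 'r) atom \<Rightarrow> bool" where
  "well_sorted_atom V P (Input R ys) \<longleftrightarrow> R \<in> symbols V \<and> map fst ys = arity V R"
| "well_sorted_atom V P (Intensional q ys) \<longleftrightarrow> map fst ys = idb_arity P q"

definition datalog_program :: "('s, 'r) vocab \<Rightarrow> ('s, 'r) program \<Rightarrow> bool" where
  "datalog_program V P \<longleftrightarrow>
     (\<forall>q. set (idb_arity P q) \<subseteq> sorts V) \<and>
     (\<forall>r\<in>set (rules P). map fst (head_args r) = idb_arity P (head_pred r) \<and>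
        (\<forall>a\<in>set (body r). well_sorted_atom V P a))"

inductive derivable :: "('s, 'r) program \<Rightarrow> ('s, 'r, 'a) relstruct \<Rightarrow> nat \<Rightarrow> 'a list \<Rightarrow> bool"
  for P B where
  "\<lbrakk>r \<in> set (rules P);
    \<forall>v\<in>rule_vars r. \<alpha> v \<in> sort_dom B (fst v);
    \<forall>R ys. Input R ys \<in> set (body r) \<longrightarrow> map \<alpha> ys \<in> interp B R;
    \<forall>q ys. Intensional q ys \<in> set (body r) \<longrightarrow> derivable P B q (map \<alpha> ys)\<rbrakk>
   \<Longrightarrow> derivable P B (head_pred r) (map \<alpha> (head_args r))"

definition datalog_output :: "('s, 'r) program \<Rightarrow> ('s, 'r, 'a) relstruct \<Rightarrow> 'a list set" where
  "datalog_output P B = {xs. derivable P B (out_pred P) xs}"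

definition out_length :: "('s, 'r) program \<Rightarrow> nat" where
  "out_length P = length (idb_arity P (out_pred P))"

section \<open>Datalog interpretations, union gadgets and reductions\<close>

record ('s, 'r, 't, 'q) dl_interp =
  sort_prog :: "'t \<Rightarrow> ('s, 'r) program"
  symbol_prog :: "'q \<Rightarrow> ('s, 'r) program"

definition datalog_interpretation ::
    "('s, 'r) vocab \<Rightarrow> ('t, 'q) vocab \<Rightarrow> ('s, 'r, 't, 'q) dl_interp \<Rightarrow> bool" where
  "datalog_interpretation V W \<phi> \<longleftrightarrow> vocabulary V \<and> vocabulary W \<and>
     (\<forall>t\<in>sorts W. datalog_program V (sort_prog \<phi> t)) \<and>
     (\<forall>R\<in>symbols W. datalog_program V (symbol_prog \<phi> R) \<and>
        out_length (symbol_prog \<phi> R) =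
          sum_list (map (\<lambda>t. out_length (sort_prog \<phi> t)) (arity W R)))"

text \<open>Elements of sort \<open>t\<close> are tagged with \<open>t\<close>, so that the domains are disjoint.\<close>

definition interpreted ::
    "('t, 'q) vocab \<Rightarrow> ('s, 'r, 't, 'q) dl_interp \<Rightarrow> ('s, 'r, 'a) relstruct \<Rightarrow>
     ('t, 'q, 't \<times> 'a list) relstruct" where
  "interpreted W \<phi> B =
     \<lparr>sort_dom = (\<lambda>t. Pair t ` datalog_output (sort_prog \<phi> t) B),
      interp = (\<lambda>R. {zip (arity W R) as |as.
          list_all2 (\<lambda>t a. a \<in> datalog_output (sort_prog \<phi> t) B) (arity W R) as \<and>
          concat as \<in> datalog_output (symbol_prog \<phi> R) B})\<rparr>"

definition union_gadget ::
    "('t, 'q) vocab \<Rightarrow> ('s, 'r) vocab \<Rightarrow> ('t \<Rightarrow> 's) \<Rightarrow> ('q \<Rightarrow> 'r) \<Rightarrow> bool" where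
  "union_gadget W V d \<rho> \<longleftrightarrow> vocabulary W \<and> vocabulary V \<and>
     d ` sorts W \<subseteq> sorts V \<and> \<rho> ` symbols W \<subseteq> symbols V \<and>
     (\<forall>R\<in>symbols W. arity V (\<rho> R) = map d (arity W R))"

text \<open>The first union is disjoint because the domains of the sorts are.\<close>

definition apply_gadget ::
    "('t, 'q) vocab \<Rightarrow> ('t \<Rightarrow> 's) \<Rightarrow> ('q \<Rightarrow> 'r) \<Rightarrow> ('t, 'q, 'a) relstruct \<Rightarrow> ('s, 'r, 'a) relstruct" where
  "apply_gadget W d \<rho> C =
     \<lparr>sort_dom = (\<lambda>s. \<Union>t\<in>{t\<in>sorts W. d t = s}. sort_dom C t),
      interp = (\<lambda>R. \<Union>Q\<in>{Q\<in>symbols W. \<rho> Q = R}. interp C Q)\<rparr>"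

text \<open>Sorts and symbols of the finite intermediate vocabulary, and elements of the finite
  instances, are taken to be natural numbers. This loses no generality up to renaming.\<close>

definition datalog_union_reducible ::
    "('s, 'r) vocab \<Rightarrow> ('s, 'r, 'a) relstruct \<Rightarrow> ('s2, 'r2) vocab \<Rightarrow> ('s2, 'r2, 'b) relstruct \<Rightarrow> bool" where
  "datalog_union_reducible V1 A1 V2 A2 \<longleftrightarrow>
     (\<exists>(W :: (nat, nat) vocab) \<phi> d \<rho>.
        datalog_interpretation V1 W \<phi> \<and> union_gadget W V2 d \<rho> \<and>
        (\<forall>B :: ('s, 'r, nat) relstruct. finite_structure V1 B \<longrightarrow>
           finite_structure V2 (apply_gadget W d \<rho> (interpreted W \<phi> B)) \<and>
           (B \<in> CSP V1 A1 \<longleftrightarrow> apply_gadget W d \<rho> (interpreted W \<phi> B) \<in> CSP V2 A2)))"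

end

theory Submission
  imports Defs "HOL-Library.Numeral_Type" "HOL-Library.Function_Algebras"
begin

text \<open>
  A Cai-Fuerer-Immerman argument over \<open>\<int>\<^sub>7\<close>. On a complete graph with more vertices than
  any rule of the reduction \<open>\<psi>\<close> has variables, consider the 3-colouring instance expressing that
  there is a \<open>\<int>\<^sub>7\<close>-flow with prescribed net outflow at every vertex. With outflow \<open>0\<close> everywhere
  (\<open>B\<^sub>0\<close>) it is satisfiable; with outflow \<open>1\<close> at a single vertex (\<open>B\<close>) it is not. The group \<open>\<Gamma>\<close> of
  circulations acts on \<open>B\<^sub>0\<close>, and every small part of \<open>B\<close> maps into \<open>B\<^sub>0\<close>, uniquely up to \<open>\<Gamma>\<close>.

  The or-structure is the disjoint union of an affine \<open>\<int>\<^sub>2\<close>-part and an affine \<open>\<int>\<^sub>3\<close>-part, and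
  \<open>|\<Gamma>|\<close> is a power of \<open>7\<close>, hence congruent to \<open>1\<close> modulo \<open>6\<close>. So a homomorphism from \<open>\<psi>(B\<^sub>0)\<close> can be
  averaged over \<open>\<Gamma>\<close>. The resulting invariant homomorphism composes with the local maps to a
  well-defined homomorphism on \<open>\<psi>(B)\<close>, although \<open>B\<close> is not 3-colourable.
\<close>

section \<open>Datalog under partial maps\<close>

definition width_le :: "nat \<Rightarrow> ('s, 'r) program \<Rightarrow> bool" where
  "width_le k P \<longleftrightarrow> (\<forall>r\<in>set (rules P). card (rule_vars r) \<le> k)"

lemma finite_rule_vars: "finite (rule_vars r)"
  by (simp add: rule_vars_def)

text \<open>The last rule of a derivation instantiates at most \<open>k\<close> variables, those of
  the head among them, so even a long output tuple has at most \<open>k\<close> distinct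
  entries.\<close>

lemma derivable_support:
  assumes "derivable P B q xs" "width_le k P"
  shows "card (set xs) \<le> k" "set xs \<subseteq> (\<Union>s. sort_dom B s)"
proof -
  from assms(1) obtain r \<alpha> where r: "r \<in> set (rules P)" "xs = map \<alpha> (head_args r)"
    "\<forall>v\<in>rule_vars r. \<alpha> v \<in> sort_dom B (fst v)"
    by cases auto
  have sub: "set xs \<subseteq> \<alpha> ` rule_vars r"
    using r(2) by (auto simp: rule_vars_def)
  then have "card (set xs) \<le> card (rule_vars r)"
    by (rule surj_card_le[OF finite_rule_vars])
  then show "card (set xs) \<le> k"
    using assms(2) r(1) by (auto simp: width_le_def)
  show "set xs \<subseteq> (\<Union>s. sort_dom B s)"
    using sub r(3) by blast
qed

text \<open>The winning strategies of Duplicator in the existential \<open>k\<close>-pebble game: \<open>F U\<close> collects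
  the positions with domain \<open>U\<close>, each represented by a function that matters on \<open>U\<close> only.\<close>

locale partial_maps =
  fixes k :: nat and B :: "('s, 'r, 'a) relstruct" and B' :: "('s, 'r, 'b) relstruct"
    and F :: "'a set \<Rightarrow> ('a \<Rightarrow> 'b) set"
  assumes restrict: "f \<in> F U \<Longrightarrow> Z \<subseteq> U \<Longrightarrow> f \<in> F Z"
    and extend: "f \<in> F U \<Longrightarrow> U \<subseteq> Z \<Longrightarrow> finite Z \<Longrightarrow> card Z \<le> k \<Longrightarrow> Z \<subseteq> (\<Union>s. sort_dom B s) \<Longrightarrow>
      \<exists>f'\<in>F Z. \<forall>x\<in>U. f' x = f x"
    and dom: "f \<in> F U \<Longrightarrow> x \<in> U \<Longrightarrow> x \<in> sort_dom B s \<Longrightarrow> f x \<in> sort_dom B' s"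
    and rel: "f \<in> F U \<Longrightarrow> xs \<in> interp B R \<Longrightarrow> set xs \<subseteq> U \<Longrightarrow> map f xs \<in> interp B' R"
begin

text \<open>Each rule application is one round of the game: the position on the head is extended to
  all elements of the rule instance and then restricted to each body atom. Intermediate tuples are
  mapped by other maps than \<open>f\<close>, hence the induction for arbitrary
  \<open>f\<close>.\<close>

lemma derivable_map:
  assumes "derivable P B q xs" "width_le k P" "f \<in> F (set xs)"
  shows "derivable P B' q (map f xs)"
  using assms(1,3)
proof (induction arbitrary: f rule: derivable.induct)
  case (1 r \<alpha>)
  let ?Z = "\<alpha> ` rule_vars r"
  have sub: "set (map \<alpha> (head_args r)) \<subseteq> ?Z"
    by (auto simp: rule_vars_def)
  have "card ?Z \<le> k"
    using card_image_le[OF finite_rule_vars, of \<alpha> r] assms(2) 1(1)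
    by (force simp: width_le_def)
  moreover have "?Z \<subseteq> (\<Union>s. sort_dom B s)"
    using 1(2) by blast
  ultimately obtain f' where f': "f' \<in> F ?Z" "\<forall>x\<in>set (map \<alpha> (head_args r)). f' x = f x"
    using extend[OF 1(5) sub finite_imageI[OF finite_rule_vars]] by blast
  have body: "set (map \<alpha> (args a)) \<subseteq> ?Z" if "a \<in> set (body r)" for a
    using that by (auto simp: rule_vars_def)
  have "derivable P B' (head_pred r) (map (f' \<circ> \<alpha>) (head_args r))"
  proof (rule derivable.intros[OF 1(1)], intro ballI)
    show "(f' \<circ> \<alpha>) v \<in> sort_dom B' (fst v)" if "v \<in> rule_vars r" for v
      using that 1(2) dom[OF f'(1)] by simp
    show "\<forall>R ys. Input R ys \<in> set (body r) \<longrightarrow> map (f' \<circ> \<alpha>) ys \<in> interp B' R"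
    proof (intro allI impI)
      fix R ys
      assume "Input R ys \<in> set (body r)"
      then have "map \<alpha> ys \<in> interp B R" "set (map \<alpha> ys) \<subseteq> ?Z"
        using 1(3) body by fastforce+
      from rel[OF f'(1) this] show "map (f' \<circ> \<alpha>) ys \<in> interp B' R"
        by simp
    qed
    show "\<forall>p ys. Intensional p ys \<in> set (body r) \<longrightarrow> derivable P B' p (map (f' \<circ> \<alpha>) ys)"
    proof (intro allI impI)
      fix p ys
      assume a: "Intensional p ys \<in> set (body r)"
      then have "f' \<in> F (set (map \<alpha> ys))"
        using restrict[OF f'(1) body] by fastforce
      then show "derivable P B' p (map (f' \<circ> \<alpha>) ys)"
        using 1(4) a by (simp flip: map_map)
    qed
  qed
  moreover have "map (f' \<circ> \<alpha>) (head_args r) = map f (map \<alpha> (head_args r))"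
    using f'(2) by simp
  ultimately show ?case
    by simp
qed

lemma datalog_output_map:
  "xs \<in> datalog_output P B \<Longrightarrow> width_le k P \<Longrightarrow> f \<in> F (set xs) \<Longrightarrow> map f xs \<in> datalog_output P B'"
  by (simp add: datalog_output_def derivable_map)

end

section \<open>Reductions under partial maps\<close>

definition reduct ::
    "('t, 'q) vocab \<Rightarrow> ('s, 'r, 't, 'q) dl_interp \<Rightarrow> ('t \<Rightarrow> 's2) \<Rightarrow> ('q \<Rightarrow> 'r2) \<Rightarrow>
     ('s, 'r, 'a) relstruct \<Rightarrow> ('s2, 'r2, 't \<times> 'a list) relstruct" where
  "reduct W \<phi> d \<rho> B = apply_gadget W d \<rho> (interpreted W \<phi> B)"

definition interp_width_le :: "nat \<Rightarrow> ('t, 'q) vocab \<Rightarrow> ('s, 'r, 't, 'q) dl_interp \<Rightarrow> bool" where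
  "interp_width_le k W \<phi> \<longleftrightarrow> (\<forall>t\<in>sorts W. width_le k (sort_prog \<phi> t)) \<and>
     (\<forall>Q\<in>symbols W. width_le k (symbol_prog \<phi> Q))"

definition tuple_map :: "('a \<Rightarrow> 'b) \<Rightarrow> 't \<times> 'a list \<Rightarrow> 't \<times> 'b list" where
  "tuple_map f = map_prod id (map f)"

lemma interp_width_exists:
  assumes "vocabulary W"
  shows "\<exists>k. interp_width_le k W \<phi>"
proof -
  let ?P = "sort_prog \<phi> ` sorts W \<union> symbol_prog \<phi> ` symbols W"
  let ?R = "\<Union>P\<in>?P. set (rules P)"
  let ?k = "Max (insert 0 ((card \<circ> rule_vars) ` ?R))"
  have fin: "finite ?R"
    using assms by (simp add: vocabulary_def)
  have "width_le ?k P" if "P \<in> ?P" for P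
    unfolding width_le_def
  proof
    fix r
    assume "r \<in> set (rules P)"
    then have "(card \<circ> rule_vars) r \<in> (card \<circ> rule_vars) ` ?R"
      using that by (intro imageI UN_I)
    then show "card (rule_vars r) \<le> ?k"
      using fin by (intro Max_ge) auto
  qed
  then show ?thesis
    unfolding interp_width_le_def by blast
qed

lemma reduct_dom_iff:
  "x \<in> sort_dom (reduct W \<phi> d \<rho> B) s \<longleftrightarrow>
     fst x \<in> sorts W \<and> d (fst x) = s \<and> snd x \<in> datalog_output (sort_prog \<phi> (fst x)) B"
  by (cases x) (auto simp: reduct_def apply_gadget_def interpreted_def)

lemma reduct_interpE:
  assumes "xs \<in> interp (reduct W \<phi> d \<rho> B) R"
  obtains Q as where "Q \<in> symbols W" "\<rho> Q = R" "xs = zip (arity W Q) as"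
    "list_all2 (\<lambda>t a. a \<in> datalog_output (sort_prog \<phi> t) B) (arity W Q) as"
    "concat as \<in> datalog_output (symbol_prog \<phi> Q) B"
  using assms by (auto simp: reduct_def apply_gadget_def interpreted_def)

lemma reduct_interpI:
  assumes "Q \<in> symbols W" "\<rho> Q = R"
    "list_all2 (\<lambda>t a. a \<in> datalog_output (sort_prog \<phi> t) B) (arity W Q) as"
    "concat as \<in> datalog_output (symbol_prog \<phi> Q) B"
  shows "zip (arity W Q) as \<in> interp (reduct W \<phi> d \<rho> B) R"
  using assms by (auto simp: reduct_def apply_gadget_def interpreted_def)

lemma reduct_dom_support:
  assumes "x \<in> sort_dom (reduct W \<phi> d \<rho> B) s" "interp_width_le k W \<phi>"
  shows "card (set (snd x)) \<le> k" "set (snd x) \<subseteq> (\<Union>s. sort_dom B s)"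
proof -
  have "derivable (sort_prog \<phi> (fst x)) B (out_pred (sort_prog \<phi> (fst x))) (snd x)"
    "width_le k (sort_prog \<phi> (fst x))"
    using assms by (auto simp: reduct_dom_iff datalog_output_def interp_width_le_def)
  note derivable_support[OF this]
  then show "card (set (snd x)) \<le> k" "set (snd x) \<subseteq> (\<Union>s. sort_dom B s)" .
qed

lemma UN_snd_zip:
  "length ts = length as \<Longrightarrow> (\<Union>x\<in>set (zip ts as). set (snd x)) = set (concat as)"
  by (induction ts as rule: list_induct2) auto

text \<open>The concatenation of the entries is an output tuple of a single program, so all entries
  together involve at most \<open>k\<close> base elements and one partial map can cover
  them.\<close>

lemma reduct_interp_support:
  assumes "xs \<in> interp (reduct W \<phi> d \<rho> B) R" "interp_width_le k W \<phi>"
  shows "card (\<Union>x\<in>set xs. set (snd x)) \<le> k" "(\<Union>x\<in>set xs. set (snd x)) \<subseteq> (\<Union>s. sort_dom B s)"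
proof -
  obtain Q as where Q: "Q \<in> symbols W" "xs = zip (arity W Q) as"
    "list_all2 (\<lambda>t a. a \<in> datalog_output (sort_prog \<phi> t) B) (arity W Q) as"
    "concat as \<in> datalog_output (symbol_prog \<phi> Q) B"
    using assms(1) by (rule reduct_interpE)
  have eq: "(\<Union>x\<in>set xs. set (snd x)) = set (concat as)"
    using Q(2,3) UN_snd_zip list_all2_lengthD by blast
  have "derivable (symbol_prog \<phi> Q) B (out_pred (symbol_prog \<phi> Q)) (concat as)"
    "width_le k (symbol_prog \<phi> Q)"
    using Q assms(2) by (simp_all add: datalog_output_def interp_width_le_def)
  note derivable_support[OF this]
  then show "card (\<Union>x\<in>set xs. set (snd x)) \<le> k"
    "(\<Union>x\<in>set xs. set (snd x)) \<subseteq> (\<Union>s. sort_dom B s)"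
    unfolding eq by simp_all
qed

context partial_maps
begin

lemma reduct_dom_map:
  assumes "x \<in> sort_dom (reduct W \<phi> d \<rho> B) s" "interp_width_le k W \<phi>" "f \<in> F (set (snd x))"
  shows "tuple_map f x \<in> sort_dom (reduct W \<phi> d \<rho> B') s"
  using assms datalog_output_map[of "snd x" "sort_prog \<phi> (fst x)" f]
  by (auto simp: reduct_dom_iff tuple_map_def interp_width_le_def)

lemma reduct_interp_map:
  assumes "xs \<in> interp (reduct W \<phi> d \<rho> B) R" "interp_width_le k W \<phi>" "vocabulary W"
    "f \<in> F (\<Union>x\<in>set xs. set (snd x))"
  shows "map (tuple_map f) xs \<in> interp (reduct W \<phi> d \<rho> B') R"
proof -
  obtain Q as where Q: "Q \<in> symbols W" "\<rho> Q = R" "xs = zip (arity W Q) as"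
    "list_all2 (\<lambda>t a. a \<in> datalog_output (sort_prog \<phi> t) B) (arity W Q) as"
    "concat as \<in> datalog_output (symbol_prog \<phi> Q) B"
    using assms(1) by (rule reduct_interpE)
  have len: "length (arity W Q) = length as"
    using Q(4) by (rule list_all2_lengthD)
  have f: "f \<in> F (set (concat as))"
    using assms(4) Q(3) UN_snd_zip[OF len] by simp
  have srt: "set (arity W Q) \<subseteq> sorts W"
    using assms(3) Q(1) by (auto simp: vocabulary_def)
  \<comment> \<open>Membership in the relation also requires every entry to satisfy its sort
    program; there \<open>f\<close> is restricted to the base elements of that entry.\<close>
  have "map f a \<in> datalog_output (sort_prog \<phi> t) B'" if "(t, a) \<in> set (zip (arity W Q) as)" for t a
  proof (rule datalog_output_map)
    have "a \<in> set as" "t \<in> sorts W"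
      using that srt by (auto dest: set_zip_leftD set_zip_rightD)
    then show "f \<in> F (set a)" "width_le k (sort_prog \<phi> t)"
      using restrict[OF f, of "set a"] assms(2) by (auto simp: interp_width_le_def)
    show "a \<in> datalog_output (sort_prog \<phi> t) B"
      using Q(4) that by (auto simp: list_all2_iff)
  qed
  then have "list_all2 (\<lambda>t a. a \<in> datalog_output (sort_prog \<phi> t) B') (arity W Q) (map (map f) as)"
    using len by (auto simp: list_all2_iff zip_map2)
  moreover have "concat (map (map f) as) \<in> datalog_output (symbol_prog \<phi> Q) B'"
    using datalog_output_map[OF Q(5) _ f] assms(2) Q(1)
    by (simp add: interp_width_le_def map_concat)
  ultimately have "zip (arity W Q) (map (map f) as) \<in> interp (reduct W \<phi> d \<rho> B') R"
    using Q(1,2) by (intro reduct_interpI)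
  then show ?thesis
    by (simp add: Q(3) tuple_map_def zip_map2 map_prod_def id_def)
qed

end

lemma reduct_hom:
  assumes "\<And>s x. x \<in> sort_dom B s \<Longrightarrow> f x \<in> sort_dom B' s"
    and "\<And>R xs. xs \<in> interp B R \<Longrightarrow> map f xs \<in> interp B' R"
    and "vocabulary W"
  shows "homomorphism V (tuple_map f) (reduct W \<phi> d \<rho> B) (reduct W \<phi> d \<rho> B')"
proof -
  obtain k where k: "interp_width_le k W \<phi>"
    using interp_width_exists[OF assms(3)] by blast
  \<comment> \<open>A total homomorphism is a constant strategy.\<close>
  interpret partial_maps k B B' "\<lambda>U. {f}"
    by unfold_locales (use assms in auto)
  show ?thesis
    unfolding homomorphism_def
  proof (intro conjI ballI image_subsetI)
    show "tuple_map f x \<in> sort_dom (reduct W \<phi> d \<rho> B') s"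
      if "x \<in> sort_dom (reduct W \<phi> d \<rho> B) s" for x s
      using reduct_dom_map[OF that k] by blast
    show "map (tuple_map f) xs \<in> interp (reduct W \<phi> d \<rho> B') R"
      if "xs \<in> interp (reduct W \<phi> d \<rho> B) R" for xs R
      using reduct_interp_map[OF that k assms(3)] by blast
  qed
qed

lemma homomorphism_comp:
  "homomorphism V f A B \<Longrightarrow> homomorphism V g B C \<Longrightarrow> homomorphism V (g \<circ> f) A C"
  unfolding homomorphism_def by (auto simp: image_subset_iff simp flip: map_map)

text \<open>The partial maps are unique up to \<open>\<Gamma>\<close>, so an element of the reduct of \<open>B\<close> may be sent to
  the reduct of \<open>B'\<close> by any of them before applying the \<open>\<Gamma>\<close>-invariant \<open>h\<close>.\<close>

lemma (in partial_maps) reduct_hom_of_invariant: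
  assumes "interp_width_le k W \<phi>" "vocabulary W" "F {} \<noteq> {}"
    and hom: "homomorphism V h (reduct W \<phi> d \<rho> B') A" and "sorts V = UNIV"
    and inv: "\<And>g x s. g \<in> \<Gamma> \<Longrightarrow> x \<in> sort_dom (reduct W \<phi> d \<rho> B') s \<Longrightarrow> h (tuple_map g x) = h x"
    and trans: "\<And>U f f'. f \<in> F U \<Longrightarrow> f' \<in> F U \<Longrightarrow> finite U \<Longrightarrow> card U \<le> k \<Longrightarrow> U \<subseteq> (\<Union>s. sort_dom B s) \<Longrightarrow>
      \<exists>g\<in>\<Gamma>. \<forall>x\<in>U. f' x = g (f x)"
    and typed: "\<And>R xs. R \<in> symbols V \<Longrightarrow> xs \<in> interp (reduct W \<phi> d \<rho> B) R \<Longrightarrow>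
      \<forall>x\<in>set xs. \<exists>s. x \<in> sort_dom (reduct W \<phi> d \<rho> B) s"
  shows "\<exists>h'. homomorphism V h' (reduct W \<phi> d \<rho> B) A"
proof -
  have ex: "\<exists>f. f \<in> F U" if "finite U" "card U \<le> k" "U \<subseteq> (\<Union>s. sort_dom B s)" for U
    using assms(3) extend[OF _ empty_subsetI that] by blast
  define H where "H x = h (tuple_map (SOME f. f \<in> F (set (snd x))) x)" for x
  have H: "H x = h (tuple_map f x)"
    if x: "x \<in> sort_dom (reduct W \<phi> d \<rho> B) s" and f: "f \<in> F (set (snd x))" for x s f
  proof -
    let ?f' = "SOME f. f \<in> F (set (snd x))"
    have "?f' \<in> F (set (snd x))"
      using f by (rule someI[where P = "\<lambda>f. f \<in> F (set (snd x))"])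
    then obtain g where g: "g \<in> \<Gamma>" "\<forall>y\<in>set (snd x). ?f' y = g (f y)"
      using trans[OF f] reduct_dom_support[OF x assms(1)] by blast
    have "tuple_map ?f' x = tuple_map g (tuple_map f x)"
      using g(2) by (simp add: tuple_map_def map_prod_def case_prod_beta)
    then show ?thesis
      using inv[OF g(1) reduct_dom_map[OF x assms(1) f]] by (simp add: H_def)
  qed
  have "homomorphism V H (reduct W \<phi> d \<rho> B) A"
    unfolding homomorphism_def
  proof (intro conjI ballI image_subsetI)
    fix s x
    assume x: "x \<in> sort_dom (reduct W \<phi> d \<rho> B) s"
    obtain f where f: "f \<in> F (set (snd x))"
      using ex[OF _ reduct_dom_support[OF x assms(1)]] by blast
    show "H x \<in> sort_dom A s"
      using H[OF x f] reduct_dom_map[OF x assms(1) f] hom \<open>sorts V = UNIV\<close>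
      by (auto simp: homomorphism_def)
  next
    fix R xs
    assume R: "R \<in> symbols V" and xs: "xs \<in> interp (reduct W \<phi> d \<rho> B) R"
    \<comment> \<open>\<open>H\<close> chooses a map for each entry separately; one \<open>f\<close>
      covering the whole tuple may replace all these choices.\<close>
    obtain f where f: "f \<in> F (\<Union>x\<in>set xs. set (snd x))"
      using ex[OF _ reduct_interp_support[OF xs assms(1)]] by blast
    have "H x = h (tuple_map f x)" if x: "x \<in> set xs" for x
    proof -
      obtain s where "x \<in> sort_dom (reduct W \<phi> d \<rho> B) s"
        using typed[OF R xs] x by blast
      moreover have "f \<in> F (set (snd x))"
        using x by (intro restrict[OF f]) blast
      ultimately show ?thesis
        by (rule H)
    qed
    then have "map H xs = map h (map (tuple_map f) xs)"
      by simp
    also have "\<dots> \<in> interp A R"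
      using reduct_interp_map[OF xs assms(1,2) f] hom R by (auto simp: homomorphism_def simp del: map_map)
    finally show "map H xs \<in> interp A R" .
  qed
  then show ?thesis
    by blast
qed

section \<open>Averaging homomorphisms to the or-structure\<close>

text \<open>A coset in an abelian group is closed under integer combinations whose coefficients sum
  to \<open>1\<close>: the offset \<open>\<delta>\<close> is added \<open>card S\<close> times,
  which modulo \<open>m\<close> is once.\<close>

lemma coset_sum_closed:
  assumes D: "subgroup D (group_power (integer_mod_group m) r)"
    and C: "C \<in> rcosets\<^bsub>group_power (integer_mod_group m) r\<^esub> D"
    and S: "finite S" "int (card S) mod int m = 1 mod int m"
    and f: "\<And>s. s \<in> S \<Longrightarrow> f s \<in> C"
  shows "(\<lambda>i\<in>{..<r}. (\<Sum>s\<in>S. f s i) mod int m) \<in> C"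
proof -
  let ?P = "group_power (integer_mod_group m) r"
  have mult: "x \<otimes>\<^bsub>?P\<^esub> y = (\<lambda>i\<in>{..<r}. (x i + y i) mod int m)" for x y
    by (simp add: group_power_def integer_mod_group_def)
  have one: "\<one>\<^bsub>?P\<^esub> = (\<lambda>i\<in>{..<r}. 0)"
    by (simp add: group_power_def)
  from C obtain \<delta> where C: "C = D #>\<^bsub>?P\<^esub> \<delta>"
    by (auto simp: RCOSETS_def)
  have "\<forall>s\<in>S. \<exists>d\<in>D. f s = d \<otimes>\<^bsub>?P\<^esub> \<delta>"
    using f by (auto simp: C r_coset_def)
  then obtain d where d: "\<And>s. s \<in> S \<Longrightarrow> d s \<in> D" "\<And>s. s \<in> S \<Longrightarrow> f s = d s \<otimes>\<^bsub>?P\<^esub> \<delta>"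
    by metis
  have sum: "(\<lambda>i\<in>{..<r}. (\<Sum>s\<in>T. d s i) mod int m) \<in> D" if "finite T" "T \<subseteq> S" for T
    using that
  proof (induction T rule: finite_induct)
    case empty
    then show ?case
      using subgroup.one_closed[OF D] by (simp add: one restrict_def)
  next
    case (insert s T)
    then have "d s \<in> D" "(\<lambda>i\<in>{..<r}. (\<Sum>s\<in>T. d s i) mod int m) \<in> D"
      using d(1) by blast+
    then have "d s \<otimes>\<^bsub>?P\<^esub> (\<lambda>i\<in>{..<r}. (\<Sum>s\<in>T. d s i) mod int m) \<in> D"
      by (rule subgroup.m_closed[OF D])
    also have "d s \<otimes>\<^bsub>?P\<^esub> (\<lambda>i\<in>{..<r}. (\<Sum>s\<in>T. d s i) mod int m) =
        (\<lambda>i\<in>{..<r}. (\<Sum>s\<in>insert s T. d s i) mod int m)"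
      using insert(1,2) by (auto simp: mult mod_add_right_eq)
    finally show ?case .
  qed
  have "(\<Sum>s\<in>S. f s i) mod int m = ((\<Sum>s\<in>S. d s i) mod int m + \<delta> i) mod int m" if "i < r" for i
  proof -
    have "(\<Sum>s\<in>S. f s i) mod int m = (\<Sum>s\<in>S. (d s i + \<delta> i) mod int m) mod int m"
      using that d(2) by (simp add: mult)
    also have "\<dots> = ((\<Sum>s\<in>S. d s i) + int (card S) * \<delta> i) mod int m"
      by (simp add: mod_sum_eq sum.distrib)
    also have "\<dots> = ((\<Sum>s\<in>S. d s i) mod int m + ((int (card S) mod int m) * \<delta> i) mod int m) mod int m"
      by (simp add: mod_simps)
    also have "\<dots> = ((\<Sum>s\<in>S. d s i) mod int m + \<delta> i) mod int m"
      unfolding S(2) by (simp add: mod_simps)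
    finally show ?thesis .
  qed
  then have "(\<lambda>i\<in>{..<r}. (\<Sum>s\<in>S. f s i) mod int m) =
      (\<lambda>i\<in>{..<r}. (\<Sum>s\<in>S. d s i) mod int m) \<otimes>\<^bsub>?P\<^esub> \<delta>"
    by (auto simp: mult)
  also have "\<dots> \<in> C"
    using sum[OF S(1)] by (auto simp: C r_coset_def)
  finally show ?thesis .
qed

text \<open>\<open>E\<close> will be \<open>ElemL\<close> or \<open>ElemR\<close>. The average is
  formed element by element, without reference to a tuple; on \<open>xs\<close> it agrees with the
  sum of the coset elements that represent the tuples.\<close>

lemma coset_average:
  assumes P: "P \<in> symbols (coset_vocab (integer_mod_group m) r)"
    and S: "finite S" "S \<noteq> {}" "int (card S) mod int m = 1 mod int m" and E: "inj E"
    and tuples: "\<And>s. s \<in> S \<Longrightarrow>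
      map (H s) xs \<in> map E ` interp (coset_structure (integer_mod_group m) r) P"
  shows "map (\<lambda>x. E ((\<Sum>s\<in>S. the_inv E (H s x)) mod int m)) xs
    \<in> map E ` interp (coset_structure (integer_mod_group m) r) P"
proof -
  obtain D where D: "subgroup D (group_power (integer_mod_group m) r)"
    "P \<in> rcosets\<^bsub>group_power (integer_mod_group m) r\<^esub> D"
    using P by (auto simp: coset_vocab_def)
  have "\<forall>s\<in>S. \<exists>f\<in>P. map (H s) xs = map E (map f [0..<r])"
    using tuples by (fastforce simp: coset_structure_def)
  then obtain f where f: "\<And>s. s \<in> S \<Longrightarrow> f s \<in> P"
    "\<And>s. s \<in> S \<Longrightarrow> map (H s) xs = map E (map (f s) [0..<r])"
    by metis
  let ?g = "\<lambda>i\<in>{..<r}. (\<Sum>s\<in>S. f s i) mod int m"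
  obtain s0 where "s0 \<in> S"
    using S(2) by blast
  then have len: "length xs = r"
    using arg_cong[OF f(2), of s0 length] by simp
  have "the_inv E (H s (xs ! i)) = f s i" if "s \<in> S" "i < r" for s i
    using arg_cong[OF f(2)[OF that(1)], of "\<lambda>ys. ys ! i"] that len by (simp add: the_inv_f_f[OF E])
  then have "map (\<lambda>x. E ((\<Sum>s\<in>S. the_inv E (H s x)) mod int m)) xs = map E (map ?g [0..<r])"
    using len by (intro nth_equalityI) auto
  also have "\<dots> \<in> map E ` (\<lambda>f. map f [0..<r]) ` P"
    by (intro imageI coset_sum_closed[OF D S(1,3)] f(1))
  finally show ?thesis
    by (simp add: coset_structure_def)
qed

section \<open>The two components of the or-structure\<close>

lemma OR_T_interp_L:
  "interp (OR_T V1 A1 V2 A2) (SymL P) = map ElemL ` interp A1 P \<union> {replicate (length (arity V1 P)) C1}"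
  by (simp add: OR_T_def)

lemma OR_T_interp_R:
  "interp (OR_T V1 A1 V2 A2) (SymR Q) = map ElemR ` interp A2 Q \<union> {replicate (length (arity V2 Q)) C2}"
  by (simp add: OR_T_def)

lemma OR_T_interp_S:
  "interp (OR_T V1 A1 V2 A2) SymS =
     {[ElemL a, C2] |a. a \<in> sort_dom A1 ()} \<union> {[C1, ElemR b] |b. b \<in> sort_dom A2 ()}"
  by (simp add: OR_T_def)

text \<open>The or-structure is the disjoint union of two structures, and this is the universe of
  the first one.\<close>

definition left_part :: "('a, 'b) or_elem set" where
  "left_part = range ElemL \<union> {C2}"

lemma left_part_simps [simp]:
  "ElemL a \<in> left_part" "C2 \<in> left_part" "C1 \<notin> left_part" "ElemR b \<notin> left_part"
  by (auto simp: left_part_def)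

text \<open>\<open>SymS\<close> joins \<open>ElemL\<close> only to \<open>C2\<close> and
  \<open>C1\<close> only to \<open>ElemR\<close>, and a tuple of any other symbol uses a single
  constructor.\<close>

lemma OR_T_interp_one_sided:
  assumes "xs \<in> interp (OR_T V1 A1 V2 A2) R" "x \<in> set xs" "y \<in> set xs"
  shows "x \<in> left_part \<longleftrightarrow> y \<in> left_part"
proof (cases R)
  case (SymL P)
  then show ?thesis
    using assms by (auto simp: OR_T_interp_L left_part_def)
next
  case (SymR Q)
  then show ?thesis
    using assms by (auto simp: OR_T_interp_R left_part_def)
next
  case SymS
  then show ?thesis
    using assms by (auto simp: OR_T_interp_S left_part_def)
qed

section \<open>Invariant homomorphisms under a finite abelian group action\<close>

locale group_acting =
  fixes G :: "'z::ab_group_add set" and act :: "'z \<Rightarrow> 'c \<Rightarrow> 'c"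
    and V :: "(unit, ((nat \<Rightarrow> int) set, (nat \<Rightarrow> int) set) or_symbol) vocab"
    and C :: "(unit, ((nat \<Rightarrow> int) set, (nat \<Rightarrow> int) set) or_symbol, 'c) relstruct"
  assumes finite_G: "finite G" and zero_G: "0 \<in> G"
    and add_G: "\<And>g g'. g \<in> G \<Longrightarrow> g' \<in> G \<Longrightarrow> g + g' \<in> G"
    and diff_G: "\<And>g g'. g \<in> G \<Longrightarrow> g' \<in> G \<Longrightarrow> g - g' \<in> G"
    and act_hom: "\<And>g. g \<in> G \<Longrightarrow> homomorphism V (act g) C C"
    and act_act: "\<And>g g' x. g \<in> G \<Longrightarrow> g' \<in> G \<Longrightarrow> x \<in> sort_dom C () \<Longrightarrow>
      act g (act g' x) = act (g + g') x"
    and sorts_V: "sorts V = UNIV"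
    and typed: "\<And>R xs. R \<in> symbols V \<Longrightarrow> xs \<in> interp C R \<Longrightarrow> set xs \<subseteq> sort_dom C ()"
begin

lemma act_dom: "g \<in> G \<Longrightarrow> x \<in> sort_dom C () \<Longrightarrow> act g x \<in> sort_dom C ()"
  using act_hom sorts_V by (auto simp: homomorphism_def)

lemma act_interp:
  "g \<in> G \<Longrightarrow> R \<in> symbols V \<Longrightarrow> xs \<in> interp C R \<Longrightarrow> map (act g) xs \<in> interp C R"
  using act_hom by (auto simp: homomorphism_def)

text \<open>Mapping each connected component by the first translate of \<open>h\<close> that sends it to the left
  part makes the partition into the two parts invariant.\<close>

lemma invariant_side_hom:
  assumes "homomorphism V h C (OR_T V1 A1 V2 A2)"
  shows "\<exists>h' U. homomorphism V h' C (OR_T V1 A1 V2 A2) \<and>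
    (\<forall>x\<in>sort_dom C (). \<forall>g\<in>G. (h' (act g x) \<in> left_part \<longleftrightarrow> x \<in> U) \<and> (act g x \<in> U \<longleftrightarrow> x \<in> U))"
proof -
  define T where "T x = {g\<in>G. h (act g x) \<in> left_part}" for x
  \<comment> \<open>The default \<open>0\<close> lies in \<open>G\<close>, so if no translate of
    \<open>x\<close> goes left, \<open>h (act 0 x)\<close> goes right. \<open>act 0\<close> is not
    assumed to be the identity.\<close>
  define c where "c T = (if T = {} then 0 else SOME g. g \<in> T)" for T :: "'z set"
  define h' where "h' x = h (act (c (T x)) x)" for x
  define U where "U = {x. T x \<noteq> {}}"
  have c_in: "c (T x) \<in> T x" if "T x \<noteq> {}" for x
    using that by (auto simp: c_def some_in_eq)
  then have c_G: "c (T x) \<in> G" for x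
    using zero_G by (cases "T x = {}") (auto simp: c_def T_def)
  have left: "h' x \<in> left_part \<longleftrightarrow> x \<in> U" for x
    using c_in[of x] c_G[of x] by (auto simp: h'_def U_def T_def)
  have U: "act g x \<in> U \<longleftrightarrow> x \<in> U" if "x \<in> sort_dom C ()" "g \<in> G" for x g
  proof
    assume "act g x \<in> U"
    then obtain g' where "g' \<in> G" "h (act g' (act g x)) \<in> left_part"
      by (auto simp: U_def T_def)
    then show "x \<in> U"
      using that add_G act_act by (auto simp: U_def T_def)
  next
    assume "x \<in> U"
    then obtain g' where g': "g' \<in> G" "h (act g' x) \<in> left_part"
      by (auto simp: U_def T_def)
    then have "h (act (g' - g) (act g x)) \<in> left_part"
      using that diff_G act_act by simp
    then show "act g x \<in> U"
      using diff_G[OF g'(1) that(2)] by (auto simp: U_def T_def)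
  qed
  have "homomorphism V h' C (OR_T V1 A1 V2 A2)"
    unfolding homomorphism_def
  proof (intro conjI ballI image_subsetI)
    fix s x
    assume "x \<in> sort_dom C s"
    then show "h' x \<in> sort_dom (OR_T V1 A1 V2 A2) s"
      using assms act_dom[OF c_G[of x]] sorts_V by (auto simp: homomorphism_def h'_def)
  next
    fix R xs
    assume R: "R \<in> symbols V" and xs: "xs \<in> interp C R"
    have im: "map h (map (act g) xs) \<in> interp (OR_T V1 A1 V2 A2) R" if "g \<in> G" for g
      using assms R act_interp[OF that R xs] by (auto simp: homomorphism_def simp del: map_map)
    \<comment> \<open>Each translate of the tuple goes left or right as a whole, so \<open>c\<close>
      chooses the same group element for all entries.\<close>
    have T: "T x = T y" if "x \<in> set xs" "y \<in> set xs" for x y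
      using OR_T_interp_one_sided[OF im, of _ "h (act _ x)" "h (act _ y)"] that
      by (auto simp: T_def)
    show "map h' xs \<in> interp (OR_T V1 A1 V2 A2) R"
    proof (cases xs)
      case Nil
      then show ?thesis
        using im[OF zero_G] by simp
    next
      case (Cons x ys)
      have "h' y = h (act (c (T x)) y)" if "y \<in> set xs" for y
        unfolding h'_def using T[OF that, of x] Cons by simp
      then have "map h' xs = map h (map (act (c (T x))) xs)"
        by simp
      then show ?thesis
        using im[OF c_G, of x] by (simp only:)
    qed
  qed
  moreover have "(h' (act g x) \<in> left_part \<longleftrightarrow> x \<in> U) \<and> (act g x \<in> U \<longleftrightarrow> x \<in> U)"
    if "x \<in> sort_dom C ()" "g \<in> G" for x g
    using left U[OF that] by simp
  ultimately show ?thesis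
    by blast
qed

lemma sum_act:
  assumes "g \<in> G" "x \<in> sort_dom C ()"
  shows "(\<Sum>g'\<in>G. F (act g' (act g x))) = (\<Sum>g'\<in>G. F (act g' x))"
  using assms
  by (intro sum.reindex_bij_witness[of _ "\<lambda>g'. g' - g" "\<lambda>g'. g' + g"])
    (simp_all add: add_G diff_G act_act)

lemma all_act:
  assumes "g \<in> G" "x \<in> sort_dom C ()"
  shows "(\<forall>g'\<in>G. F (act g' (act g x))) \<longleftrightarrow> (\<forall>g'\<in>G. F (act g' x))"
proof
  assume l: "\<forall>g'\<in>G. F (act g' (act g x))"
  show "\<forall>g'\<in>G. F (act g' x)"
  proof
    fix g'
    assume "g' \<in> G"
    then have "F (act (g' - g) (act g x))"
      using l assms(1) diff_G by blast
    then show "F (act g' x)"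
      using assms \<open>g' \<in> G\<close> by (simp add: diff_G act_act)
  qed
qed (use assms in \<open>simp add: act_act add_G\<close>)

text \<open>As \<open>card G\<close> is \<open>1\<close> modulo \<open>m\<close> and
  \<open>n\<close>, the plain sum over the translates is an affine average, and it is invariant
  because translation permutes \<open>G\<close>.\<close>

lemma invariant_hom_to_OR_T:
  fixes m n r :: nat
  defines "V1 \<equiv> coset_vocab (integer_mod_group m) r" and "A1 \<equiv> coset_structure (integer_mod_group m) r"
  defines "V2 \<equiv> coset_vocab (integer_mod_group n) r" and "A2 \<equiv> coset_structure (integer_mod_group n) r"
  assumes V: "V = OR_T_vocab V1 V2" and hom: "homomorphism V h C (OR_T V1 A1 V2 A2)"
    and pos: "0 < m" "0 < n" "0 < r"
    and card: "int (card G) mod int m = 1 mod int m" "int (card G) mod int n = 1 mod int n"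
  shows "\<exists>h'. homomorphism V h' C (OR_T V1 A1 V2 A2) \<and>
    (\<forall>x\<in>sort_dom C (). \<forall>g\<in>G. h' (act g x) = h' x)"
proof -
  let ?A = "OR_T V1 A1 V2 A2"
  obtain h' U where h': "homomorphism V h' C ?A"
    and left: "\<And>x g. x \<in> sort_dom C () \<Longrightarrow> g \<in> G \<Longrightarrow> h' (act g x) \<in> left_part \<longleftrightarrow> x \<in> U"
    and U: "\<And>x g. x \<in> sort_dom C () \<Longrightarrow> g \<in> G \<Longrightarrow> act g x \<in> U \<longleftrightarrow> x \<in> U"
    using invariant_side_hom[OF hom] by blast
  \<comment> \<open>An element is averaged only if all its translates have group elements as values,
    and otherwise gets the constant of its side. Mixed cases meet no tuple: the side and the symbol
    decide for all translates at once whether the values are group elements or constants.\<close>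
  define H where "H x =
    (if x \<in> U then
       if \<forall>g\<in>G. h' (act g x) \<in> range ElemL
       then ElemL ((\<Sum>g\<in>G. the_inv ElemL (h' (act g x))) mod int m) else C2
     else
       if \<forall>g\<in>G. h' (act g x) \<in> range ElemR
       then ElemR ((\<Sum>g\<in>G. the_inv ElemR (h' (act g x))) mod int n) else C1)" for x
  have inv: "H (act g x) = H x" if "x \<in> sort_dom C ()" "g \<in> G" for x g
    unfolding H_def U[OF that] sum_act[OF that(2,1), of "\<lambda>x. the_inv ElemL (h' x)"]
      sum_act[OF that(2,1), of "\<lambda>x. the_inv ElemR (h' x)"]
      all_act[OF that(2,1), of "\<lambda>x. h' x \<in> range ElemL"]
      all_act[OF that(2,1), of "\<lambda>x. h' x \<in> range ElemR"] ..
  have "homomorphism V H C ?A"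
    unfolding homomorphism_def
  proof (intro conjI ballI image_subsetI)
    fix s x
    have "x mod int m \<in> sort_dom A1 s" "x mod int n \<in> sort_dom A2 s" for x s
      using pos by (simp_all add: A1_def A2_def coset_structure_def carrier_integer_mod_group)
    then show "H x \<in> sort_dom ?A s"
      by (auto simp: H_def OR_T_def)
  next
    fix R xs
    assume R: "R \<in> symbols V" and xs: "xs \<in> interp C R"
    have im: "map h' (map (act g) xs) \<in> interp ?A R" if "g \<in> G" for g
      using h' R act_interp[OF that R xs] by (auto simp: homomorphism_def simp del: map_map)
    have xs_dom: "set xs \<subseteq> sort_dom C ()"
      using typed[OF R xs] .
    have side: "(\<forall>x\<in>set xs. x \<in> U) \<or> (\<forall>x\<in>set xs. x \<notin> U)"
    proof -
      have "x \<in> U \<longleftrightarrow> y \<in> U" if "x \<in> set xs" "y \<in> set xs" for x y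
        using OR_T_interp_one_sided[OF im[OF zero_G], of "h' (act 0 x)" "h' (act 0 y)"] that
          left[OF _ zero_G] xs_dom by auto
      then show ?thesis
        by blast
    qed
    have left_xs: "h' (act g x) \<in> left_part \<longleftrightarrow> x \<in> U" if "g \<in> G" "x \<in> set xs" for g x
      using left xs_dom that by blast
    have G_ne: "G \<noteq> {}"
      using zero_G by blast
    have G_ne: "G \<noteq> {}"
      using zero_G by blast
    \<comment> \<open>Positive arity gives every tuple of a coset symbol a first entry, which
      decides its side.\<close>
    have "length ys = r" if "ys \<in> interp ?A R" "R \<noteq> SymS" for ys
      using that
      by (cases R) (auto simp: OR_T_interp_L OR_T_interp_R A1_def A2_def V1_def V2_def
          coset_structure_def coset_vocab_def)
    then have ne: "xs \<noteq> []" if "R \<noteq> SymS"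
      using im[OF zero_G] that pos by (metis length_map list.size(3) neq0_conv)
    show "map H xs \<in> interp ?A R"
    proof (cases R)
      case (SymL P)
      have P: "P \<in> symbols (coset_vocab (integer_mod_group m) r)"
        using R by (auto simp: V SymL OR_T_vocab_def V1_def)
      note A = OR_T_interp_L[of V1 A1 V2 A2 P, folded SymL]
      have x0: "hd xs \<in> set xs"
        using ne SymL by simp
      show ?thesis
        using side
      proof
        assume side: "\<forall>x\<in>set xs. x \<in> U"
        have tup: "map (h' \<circ> act g) xs \<in> map ElemL ` interp A1 P" if g: "g \<in> G" for g
        proof -
          have "map (h' \<circ> act g) xs \<noteq> replicate k C1" for k
          proof
            assume eq: "map (h' \<circ> act g) xs = replicate k C1"
            have "h' (act g (hd xs)) \<in> set (map (h' \<circ> act g) xs)"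
              using x0 by simp
            then show False
              unfolding eq
              using left_xs[OF g x0] side x0 by auto
          qed
          then show ?thesis
            using im[OF g] unfolding A by auto
        qed
        have "h' (act g x) \<in> range ElemL" if g: "g \<in> G" and x: "x \<in> set xs" for g x
        proof -
          obtain ys where ys: "map (h' \<circ> act g) xs = map ElemL ys"
            using tup[OF g] by blast
          have "h' (act g x) \<in> set (map (h' \<circ> act g) xs)"
            using x by simp
          then show ?thesis
            unfolding ys by auto
        qed
        then have "map H xs = map (\<lambda>x. ElemL ((\<Sum>g\<in>G. the_inv ElemL ((h' \<circ> act g) x)) mod int m)) xs"
          using side by (simp add: H_def)
        also have "\<dots> \<in> map ElemL ` interp A1 P"
          using tup unfolding A1_def
          by (intro coset_average[OF P finite_G G_ne card(1)]) (auto simp: inj_def comp_def)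
        finally show ?thesis
          unfolding A by blast
      next
        assume side: "\<forall>x\<in>set xs. x \<notin> U"
        \<comment> \<open>The only tuple of this symbol on the right is constantly
          \<open>C1\<close>. The translate by \<open>0\<close> alone then rules out averaging in
          \<open>ElemR\<close>, so \<open>H\<close> is \<open>C1\<close> as well.\<close>
        have "map (h' \<circ> act 0) xs \<noteq> map ElemL ys" for ys
        proof
          assume eq: "map (h' \<circ> act 0) xs = map ElemL ys"
          have "h' (act 0 (hd xs)) \<in> set (map (h' \<circ> act 0) xs)"
            using x0 by simp
          then show False
            unfolding eq
            using left_xs[OF zero_G x0] side x0 by auto
        qed
        then have rep: "map (h' \<circ> act 0) xs = replicate (length (arity V1 P)) C1"
          using im[OF zero_G] unfolding A by auto
        have "H x = C1" if x: "x \<in> set xs" for x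
        proof -
          have "h' (act 0 x) \<in> set (map (h' \<circ> act 0) xs)"
            using x by simp
          then have "h' (act 0 x) = C1"
            unfolding rep by auto
          then show ?thesis
            using zero_G side x by (force simp: H_def)
        qed
        moreover have "length xs = length (arity V1 P)"
          using arg_cong[OF rep, of length] by simp
        ultimately have "map H xs = replicate (length (arity V1 P)) C1"
          by (simp add: map_replicate_const cong: map_cong)
        then show ?thesis
          unfolding A by blast
      qed
    next
      case (SymR P)
      have P: "P \<in> symbols (coset_vocab (integer_mod_group n) r)"
        using R by (auto simp: V SymR OR_T_vocab_def V2_def)
      note A = OR_T_interp_R[of V1 A1 V2 A2 P, folded SymR]
      have x0: "hd xs \<in> set xs"
        using ne SymR by simp
      show ?thesis
        using side
      proof
        assume side: "\<forall>x\<in>set xs. x \<notin> U"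
        have tup: "map (h' \<circ> act g) xs \<in> map ElemR ` interp A2 P" if g: "g \<in> G" for g
        proof -
          have "map (h' \<circ> act g) xs \<noteq> replicate k C2" for k
          proof
            assume eq: "map (h' \<circ> act g) xs = replicate k C2"
            have "h' (act g (hd xs)) \<in> set (map (h' \<circ> act g) xs)"
              using x0 by simp
            then show False
              unfolding eq
              using left_xs[OF g x0] side x0 by auto
          qed
          then show ?thesis
            using im[OF g] unfolding A by auto
        qed
        have "h' (act g x) \<in> range ElemR" if g: "g \<in> G" and x: "x \<in> set xs" for g x
        proof -
          obtain ys where ys: "map (h' \<circ> act g) xs = map ElemR ys"
            using tup[OF g] by blast
          have "h' (act g x) \<in> set (map (h' \<circ> act g) xs)"
            using x by simp
          then show ?thesis
            unfolding ys by auto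
        qed
        then have "map H xs = map (\<lambda>x. ElemR ((\<Sum>g\<in>G. the_inv ElemR ((h' \<circ> act g) x)) mod int n)) xs"
          using side by (simp add: H_def)
        also have "\<dots> \<in> map ElemR ` interp A2 P"
          using tup unfolding A2_def
          by (intro coset_average[OF P finite_G G_ne card(2)]) (auto simp: inj_def comp_def)
        finally show ?thesis
          unfolding A by blast
      next
        assume side: "\<forall>x\<in>set xs. x \<in> U"
        have "map (h' \<circ> act 0) xs \<noteq> map ElemR ys" for ys
        proof
          assume eq: "map (h' \<circ> act 0) xs = map ElemR ys"
          have "h' (act 0 (hd xs)) \<in> set (map (h' \<circ> act 0) xs)"
            using x0 by simp
          then show False
            unfolding eq
            using left_xs[OF zero_G x0] side x0 by auto
        qed
        then have rep: "map (h' \<circ> act 0) xs = replicate (length (arity V2 P)) C2"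
          using im[OF zero_G] unfolding A by auto
        have "H x = C2" if x: "x \<in> set xs" for x
        proof -
          have "h' (act 0 x) \<in> set (map (h' \<circ> act 0) xs)"
            using x by simp
          then have "h' (act 0 x) = C2"
            unfolding rep by auto
          then show ?thesis
            using zero_G side x by (force simp: H_def)
        qed
        moreover have "length xs = length (arity V2 P)"
          using arg_cong[OF rep, of length] by simp
        ultimately have "map H xs = replicate (length (arity V2 P)) C2"
          by (simp add: map_replicate_const cong: map_cong)
        then show ?thesis
          unfolding A by blast
      qed
    next
      case SymS
      have A: "interp ?A R = {[ElemL a, C2] |a. a \<in> {0..<int m}} \<union> {[C1, ElemR b] |b. b \<in> {0..<int n}}"
        using pos by (simp add: SymS OR_T_interp_S A1_def A2_def coset_structure_def
            carrier_integer_mod_group)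
      obtain x y where xy: "xs = [x, y]"
        using im[OF zero_G] unfolding A by (auto simp: map_eq_Cons_conv)
      have dom: "x \<in> sort_dom C ()" "y \<in> sort_dom C ()"
        using xs_dom by (simp_all add: xy)
      have im: "(\<exists>a. h' (act g x) = ElemL a) \<and> h' (act g y) = C2 \<or>
          h' (act g x) = C1 \<and> (\<exists>b. h' (act g y) = ElemR b)" if "g \<in> G" for g
        using im[OF that] unfolding A xy by auto
      show ?thesis
      \<comment> \<open>\<open>SymS\<close> leaves the coordinate with group elements unrestricted,
        so any average is allowed there; the other coordinate is the same constant under all
        translates.\<close>
      proof (cases "x \<in> U")
        case True
        then have *: "h' (act g x) \<in> range ElemL" "h' (act g y) = C2" if "g \<in> G" for g
          using im[OF that] left[OF dom(1) that] by (auto simp: left_part_def)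
        have "y \<in> U"
          using left[OF dom(2) zero_G] *(2)[OF zero_G] by simp
        have "h' (act 0 y) \<notin> range ElemL"
          using *(2)[OF zero_G] by auto
        then have "H y = C2"
          using \<open>y \<in> U\<close> zero_G by (auto simp: H_def)
        moreover have "H x = ElemL ((\<Sum>g\<in>G. the_inv ElemL (h' (act g x))) mod int m)"
          using True *(1) by (simp add: H_def)
        ultimately show ?thesis
          using pos unfolding A xy by simp
      next
        case False
        then have *: "h' (act g x) = C1" "h' (act g y) \<in> range ElemR" if "g \<in> G" for g
          using im[OF that] left[OF dom(1) that] by (auto simp: left_part_def)
        have "y \<notin> U"
          using left[OF dom(2) zero_G] *(2)[OF zero_G] by auto
        have "h' (act 0 x) \<notin> range ElemR"
          using *(1)[OF zero_G] by auto
        then have "H x = C1"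
          using False zero_G by (auto simp: H_def)
        moreover have "H y = ElemR ((\<Sum>g\<in>G. the_inv ElemR (h' (act g y))) mod int n)"
          using \<open>y \<notin> U\<close> *(2) by (simp add: H_def)
        ultimately show ?thesis
          using pos unfolding A xy by simp
      qed
    qed
  qed
  then show ?thesis
    using inv by blast
qed

end

section \<open>Colourings of powers of the triangle\<close>

abbreviation colours :: "nat set" where
  "colours \<equiv> {0, 1, 2}"

text \<open>The sets \<open>A\<close> such that \<open>h\<close> maps the functions that are constant on \<open>A\<close> and on its complement
  to their value on \<open>A\<close> form a principal ultrafilter (Greenwell and Lovasz).\<close>

lemma idempotent_colouring_dictator:
  fixes h :: "('x \<Rightarrow> nat) \<Rightarrow> nat"
  assumes "finite L"
    and col: "\<And>t. t \<in> L \<rightarrow>\<^sub>E colours \<Longrightarrow> h t \<in> colours"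
    and edge: "\<And>t s. t \<in> L \<rightarrow>\<^sub>E colours \<Longrightarrow> s \<in> L \<rightarrow>\<^sub>E colours \<Longrightarrow> \<forall>x\<in>L. t x \<noteq> s x \<Longrightarrow> h t \<noteq> h s"
    and const: "\<And>a. a \<in> colours \<Longrightarrow> h (\<lambda>x\<in>L. a) = a"
  shows "\<exists>x\<in>L. \<forall>t\<in>L \<rightarrow>\<^sub>E colours. h t = t x"
proof -
  define w where "w A a b = (\<lambda>x\<in>L. if x \<in> A then a else b)" for A and a b :: nat
  have w: "w A a b \<in> L \<rightarrow>\<^sub>E colours" if "a \<in> colours" "b \<in> colours" for A a b
    using that by (auto simp: w_def)
  \<comment> \<open>If \<open>t\<close> missed the value \<open>h t\<close>, it would differ
    everywhere from the constant function with that value, which \<open>h\<close> sends to the same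
    colour.\<close>
  have range: "\<exists>x\<in>L. t x = h t" if "t \<in> L \<rightarrow>\<^sub>E colours" for t
  proof (rule ccontr)
    assume "\<not> ?thesis"
    moreover have "(\<lambda>x\<in>L. h t) \<in> L \<rightarrow>\<^sub>E colours"
      using col[OF that] by simp
    ultimately have "h t \<noteq> h (\<lambda>x\<in>L. h t)"
      using edge[OF that] by fastforce
    then show False
      using const[OF col[OF that]] by simp
  qed
  have two: "h (w A a b) = a \<or> h (w A a b) = b" if ab: "a \<in> colours" "b \<in> colours" for A a b
  proof -
    obtain x where "x \<in> L" "w A a b x = h (w A a b)"
      using range[OF w[OF ab]] by blast
    moreover have "w A a b x = a \<or> w A a b x = b"
      using \<open>x \<in> L\<close> by (simp add: w_def)
    ultimately show ?thesis
      by auto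
  qed
  \<comment> \<open>\<open>w A a b\<close> and \<open>w A b c\<close> differ both on
    \<open>A\<close> and off it, which excludes the colour \<open>b\<close> for the second.\<close>
  have rotate: "h (w A b c) = c"
    if "h (w A a b) = b" "a \<noteq> b" "b \<noteq> c" "a \<in> colours" "b \<in> colours" "c \<in> colours" for A a b c
  proof -
    have "h (w A a b) \<noteq> h (w A b c)"
      using that by (intro edge w) (auto simp: w_def)
    then show ?thesis
      using two[of b c A] that by auto
  qed
  define U where "U = {A. h (w A 0 1) = 0}"
  have U: "h (w A a b) = (if A \<in> U then a else b)"
    if "a \<noteq> b" "a \<in> colours" "b \<in> colours" for A a b
  proof -
    \<comment> \<open>Rotation reaches all six ordered pairs of colours, so whether \<open>h\<close>
      follows \<open>A\<close> or its complement does not depend on the pair.\<close>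
    have all: "h (w A a' b') = b'"
      if "h (w A a b) = b" "a \<noteq> b" "a \<in> colours" "b \<in> colours"
        "a' \<noteq> b'" "a' \<in> colours" "b' \<in> colours" for a b a' b'
    proof -
      have third: "\<exists>c\<in>colours. c \<noteq> a \<and> c \<noteq> b"
        by auto
      then obtain c where c: "c \<in> colours" "c \<noteq> a" "c \<noteq> b"
        by blast
      have "h (w A b a) = a" "h (w A b c) = c"
        using rotate[of A a b] that c by auto
      moreover from this have "h (w A a c) = c" "h (w A c a) = a" "h (w A c b) = b"
        using rotate[of A b a] rotate[of A b c] that c by auto
      moreover have "(a' = a \<or> a' = b \<or> a' = c) \<and> (b' = a \<or> b' = b \<or> b' = c)"
        using that c by auto
      ultimately show ?thesis
        using that by auto
    qed
    show ?thesis
    proof (cases "A \<in> U")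
      case True
      then have "h (w A a b) \<noteq> b"
        using all[of a b 0 1] that by (auto simp: U_def)
      then show ?thesis
        using two[OF that(2,3)] True by auto
    next
      case False
      then have "h (w A 0 1) = 1"
        using two[of 0 1 A] by (auto simp: U_def)
      then show ?thesis
        using all[of 0 1 a b] that False by auto
    qed
  qed
  have L_U: "L \<in> U"
  proof -
    have "w L 0 1 = (\<lambda>x\<in>L. 0)"
      by (auto simp: w_def)
    then show ?thesis
      using const[of 0] by (simp add: U_def)
  qed
  \<comment> \<open>The test function is \<open>b\<close> on the fibre and \<open>h t\<close> off
    it, so it differs from \<open>t\<close> everywhere and cannot get the colour
    \<open>h t\<close>.\<close>
  have fibre: "{x\<in>L. t x = h t} \<in> U" if t: "t \<in> L \<rightarrow>\<^sub>E colours" for t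
  proof -
    have "\<exists>b\<in>colours. b \<noteq> h t"
      by (metis insertCI zero_neq_one)
    then obtain b where b: "b \<in> colours" "b \<noteq> h t"
      by blast
    let ?A = "{x\<in>L. t x = h t}"
    have "h t \<noteq> h (w ?A b (h t))"
      using b col[OF t] by (intro edge w t) (auto simp: w_def)
    then show ?thesis
      using U[of b "h t" ?A] b col[OF t] by (auto split: if_splits)
  qed
  \<comment> \<open>For disjoint sets, \<open>w A 0 1\<close> and \<open>w B 0 2\<close> differ
    everywhere, yet \<open>h\<close> would send both to \<open>0\<close>.\<close>
  have disjoint: "A \<inter> B \<noteq> {}" if "A \<in> U" "B \<in> U" for A B
  proof
    assume "A \<inter> B = {}"
    then have "h (w A 0 1) \<noteq> h (w B 0 2)"
      by (intro edge w) (auto simp: w_def)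
    then show False
      using U[of 0 1 A] U[of 0 2 B] that by simp
  qed
  \<comment> \<open>Colour \<open>A\<close>, \<open>B\<close> and the rest of \<open>L\<close>
    differently: one of the three fibres is in \<open>U\<close>, and the rest is not, being disjoint
    from \<open>A \<union> B\<close>.\<close>
  have split: "A \<in> U \<or> B \<in> U" if "A \<union> B \<in> U" "A \<inter> B = {}" "A \<union> B \<subseteq> L" for A B
  proof -
    let ?t = "\<lambda>x\<in>L. if x \<in> A then 0 else if x \<in> B then 1 else (2::nat)"
    have t: "?t \<in> L \<rightarrow>\<^sub>E colours"
      by auto
    then have "h ?t \<in> colours"
      by (rule col)
    moreover have "{x\<in>L. ?t x = 0} = A" "{x\<in>L. ?t x = 1} = B" "{x\<in>L. ?t x = 2} = L - (A \<union> B)"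
      using that by (auto split: if_splits)
    moreover have "L - (A \<union> B) \<notin> U"
      using disjoint[OF that(1), of "L - (A \<union> B)"] by auto
    ultimately show ?thesis
      using fibre[OF t] by force
  qed
  have "\<exists>x\<in>A. {x} \<in> U" if "A \<in> U" "A \<subseteq> L" for A
    using finite_subset[OF that(2) \<open>finite L\<close>] that
  proof (induction A rule: finite_induct)
    case empty
    then show ?case
      using disjoint[of "{}" "{}"] by simp
  next
    case (insert x A)
    then show ?case
      using split[of "{x}" A] by auto
  qed
  then obtain x where x: "x \<in> L" "{x} \<in> U"
    using L_U by blast
  have "h t = t x" if "t \<in> L \<rightarrow>\<^sub>E colours" for t
    using disjoint[OF x(2) fibre[OF that]] by auto
  then show ?thesis
    using x(1) by blast
qed

section \<open>Twisted flows on complete graphs\<close>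

text \<open>Multiply by \<open>4\<close>, the inverse of \<open>2\<close> modulo \<open>7\<close>.
  Odd characteristic makes antisymmetry imply a zero diagonal and a zero total.\<close>

lemma double_eq_zero: "(s :: 7) + s = 0 \<Longrightarrow> s = 0"
proof -
  assume "s + s = 0"
  then have "4 * (s + s) = 0"
    by simp
  moreover have "4 * (s + s) = (8 :: 7) * s"
    by (simp add: algebra_simps)
  moreover have "(8 :: 7) = 1"
    by simp
  ultimately show ?thesis
    by simp
qed

text \<open>A flow on the complete graph on \<open>{..<n}\<close>; the net outflow of \<open>y\<close> at \<open>v\<close> is the sum of the
  row \<open>y v\<close>.\<close>

definition flow :: "nat \<Rightarrow> (nat \<Rightarrow> nat \<Rightarrow> 7) \<Rightarrow> bool" where
  "flow n y \<longleftrightarrow> (\<forall>u v. y u v = - y v u) \<and> (\<forall>u v. n \<le> v \<longrightarrow> y u v = 0)"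

lemma flow_zero: "flow n 0"
  by (simp add: flow_def)

lemma flow_antisym: "flow n y \<Longrightarrow> y u v = - y v u"
  unfolding flow_def by blast

lemma flow_support: "flow n y \<Longrightarrow> n \<le> v \<Longrightarrow> y u v = 0"
  unfolding flow_def by blast

lemma flow_add:
  assumes "flow n y" "flow n z"
  shows "flow n (y + z)"
  unfolding flow_def
proof (intro conjI allI impI)
  show "(y + z) u v = - (y + z) v u" for u v
    using flow_antisym[OF assms(1), of u v] flow_antisym[OF assms(2), of u v] by simp
  show "(y + z) u v = 0" if "n \<le> v" for u v
    using flow_support[OF assms(1) that] flow_support[OF assms(2) that] by simp
qed

lemma flow_diff:
  assumes "flow n y" "flow n z"
  shows "flow n (y - z)"
  unfolding flow_def
proof (intro conjI allI impI)
  show "(y - z) u v = - (y - z) v u" for u v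
    using flow_antisym[OF assms(1), of u v] flow_antisym[OF assms(2), of u v] by simp
  show "(y - z) u v = 0" if "n \<le> v" for u v
    using flow_support[OF assms(1) that] flow_support[OF assms(2) that] by simp
qed

lemma flow_diagonal: "flow n y \<Longrightarrow> y v v = 0"
  using double_eq_zero[of "y v v"] flow_antisym[of n y v v] by (simp add: eq_neg_iff_add_eq_0)

text \<open>Transposing the double sum negates it. This is the global obstruction to a twisted flow,
  invisible in any small part of the graph.\<close>

lemma antisymmetric_total:
  fixes y :: "nat \<Rightarrow> nat \<Rightarrow> 7"
  assumes "\<And>u v. u < n \<Longrightarrow> v < n \<Longrightarrow> y u v = - y v u"
  shows "(\<Sum>u<n. \<Sum>v<n. y u v) = 0"
proof (rule double_eq_zero)
  have "(\<Sum>u<n. \<Sum>v<n. y u v) = (\<Sum>u<n. \<Sum>v<n. - y v u)"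
    by (intro sum.cong refl assms) auto
  also have "\<dots> = - (\<Sum>v<n. \<Sum>u<n. y v u)"
    by (subst sum.swap) (simp add: sum_negf)
  finally show "(\<Sum>u<n. \<Sum>v<n. y u v) + (\<Sum>u<n. \<Sum>v<n. y u v) = 0"
    by simp
qed

text \<open>The defect at every vertex is routed to \<open>r\<close>.\<close>

lemma flow_extend:
  assumes y: "flow n y" and S: "\<And>v. v \<in> S \<Longrightarrow> (\<Sum>w<n. y v w) = b v" and r: "r < n" "r \<notin> S"
  shows "\<exists>y'. flow n y' \<and> (\<forall>v\<in>S. y' v = y v) \<and> (\<forall>v<n. v \<noteq> r \<longrightarrow> (\<Sum>w<n. y' v w) = b v)"
proof -
  \<comment> \<open>The missing outflow. It vanishes on \<open>S\<close> and at \<open>r\<close>, so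
    the rows in \<open>S\<close> stay unchanged and only the balance at \<open>r\<close> is left
    open.\<close>
  define \<delta> where "\<delta> u = (if u < n \<and> u \<noteq> r then b u - (\<Sum>w<n. y u w) else 0)" for u
  define y' where "y' u v = y u v + (if v = r then \<delta> u else 0) - (if u = r then \<delta> v else 0)" for u v
  have "flow n y'"
    unfolding flow_def
  proof (intro conjI allI impI)
    fix u v
    have "y u v = - y v u"
      using y by (rule flow_antisym)
    then show "y' u v = - y' v u"
      by (simp add: y'_def)
  next
    fix u v
    assume "n \<le> v"
    then show "y' u v = 0"
      using flow_support[OF y] r by (simp add: y'_def \<delta>_def)
  qed
  moreover have "y' v = y v" if "v \<in> S" for v
    using S[OF that] r that by (auto simp: y'_def \<delta>_def fun_eq_iff)
  moreover have "(\<Sum>w<n. y' v w) = b v" if "v < n" "v \<noteq> r" for v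
    using that r by (simp add: y'_def sum.distrib \<delta>_def)
  ultimately show ?thesis
    by blast
qed

section \<open>The group of circulations\<close>

definition circulations :: "nat \<Rightarrow> (nat \<Rightarrow> nat \<Rightarrow> 7) set" where
  "circulations n = {z. flow n z \<and> (\<forall>v<n. (\<Sum>w<n. z v w) = 0)}"

lemma circulations_zero: "0 \<in> circulations n"
  by (simp add: circulations_def flow_zero)

lemma circulations_add: "y \<in> circulations n \<Longrightarrow> z \<in> circulations n \<Longrightarrow> y + z \<in> circulations n"
  by (simp add: circulations_def flow_add sum.distrib)

lemma circulations_diff: "y \<in> circulations n \<Longrightarrow> z \<in> circulations n \<Longrightarrow> y - z \<in> circulations n"
  by (simp add: circulations_def flow_diff sum_subtractf)

lemma finite_card_supported_functions:
  assumes "finite A" "finite B"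
  shows "finite {f. (\<forall>x\<in>A. f x \<in> B) \<and> (\<forall>x. x \<notin> A \<longrightarrow> f x = c)}" (is "finite ?F")
    and "card {f. (\<forall>x\<in>A. f x \<in> B) \<and> (\<forall>x. x \<notin> A \<longrightarrow> f x = c)} = card B ^ card A"
proof -
  have "bij_betw (\<lambda>f. restrict f A) ?F (A \<rightarrow>\<^sub>E B)"
    by (rule bij_betw_byWitness[where f' = "\<lambda>f x. if x \<in> A then f x else c"])
      (auto simp: fun_eq_iff PiE_iff extensional_def)
  then show "finite ?F" "card ?F = card B ^ card A"
    using assms bij_betw_finite[of "\<lambda>f. restrict f A" ?F] bij_betw_same_card[of "\<lambda>f. restrict f A" ?F]
    by (simp_all add: finite_PiE card_funcsetE)
qed

text \<open>The circulations form a subgroup of the additive group of \<open>n\<close> by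
  \<open>n\<close> matrices over \<open>7\<close>, which has order \<open>7 ^ (n * n)\<close>;
  Lagrange's theorem applies.\<close>

lemma card_circulations:
  "finite (circulations n)" "\<exists>i. card (circulations n) = 7 ^ i"
proof -
  let ?R = "{f :: nat \<Rightarrow> 7. (\<forall>x\<in>{..<n}. f x \<in> UNIV) \<and> (\<forall>x. x \<notin> {..<n} \<longrightarrow> f x = 0)}"
  let ?M = "{f. (\<forall>x\<in>{..<n}. f x \<in> ?R) \<and> (\<forall>x. x \<notin> {..<n} \<longrightarrow> f x = 0)}"
  have R: "finite ?R" "card ?R = 7 ^ n"
    using finite_card_supported_functions[of "{..<n}" "UNIV :: 7 set" 0] by simp_all
  have M: "finite ?M" "card ?M = 7 ^ (n * n)"
    using finite_card_supported_functions[of "{..<n}" ?R 0] R by (simp_all add: power_mult)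
  define H :: "(nat \<Rightarrow> nat \<Rightarrow> 7) monoid" where
    "H = \<lparr>carrier = ?M, monoid.mult = (+), one = 0\<rparr>"
  have sub: "circulations n \<subseteq> ?M"
  proof
    fix z
    assume "z \<in> circulations n"
    then have z: "flow n z"
      by (simp add: circulations_def)
    have "z u v = 0" if "n \<le> u" for u v
      using flow_antisym[OF z, of u v] flow_support[OF z that, of v] by simp
    then show "z \<in> ?M"
      using flow_support[OF z] by (auto simp: fun_eq_iff)
  qed
  then show "finite (circulations n)"
    using M(1) by (rule finite_subset)
  have inv: "\<exists>g\<in>?M. g + f = 0" if "f \<in> ?M" for f
    using that by (intro bexI[of _ "- f"]) auto
  interpret group H
  proof (rule groupI)
    fix f
    assume "f \<in> carrier H"
    then show "\<exists>g\<in>carrier H. g \<otimes>\<^bsub>H\<^esub> f = \<one>\<^bsub>H\<^esub>"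
      unfolding H_def partial_object.simps monoid.simps by (rule inv)
  qed (auto simp: H_def add.assoc)
  have "subgroup (circulations n) H"
  proof (rule subgroupI)
    show "circulations n \<subseteq> carrier H"
      using sub by (simp add: H_def)
    show "circulations n \<noteq> {}"
      using circulations_zero by blast
    fix a
    assume a: "a \<in> circulations n"
    have neg: "- a \<in> circulations n"
      using circulations_diff[OF circulations_zero a] by simp
    moreover have "inv\<^bsub>H\<^esub> a = - a"
      using a neg sub by (intro inv_equality) (auto simp: H_def)
    ultimately show "inv\<^bsub>H\<^esub> a \<in> circulations n"
      by simp
    show "a \<otimes>\<^bsub>H\<^esub> c \<in> circulations n" if "c \<in> circulations n" for c
      using a that by (simp add: H_def circulations_add)
  qed
  then have "card (rcosets\<^bsub>H\<^esub> circulations n) * card (circulations n) = order H"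
    by (rule lagrange)
  also have "order H = 7 ^ (n * n)"
    using M(2) by (simp only: H_def order_def partial_object.simps)
  finally have "card (circulations n) dvd 7 ^ (n * n)"
    by (metis dvd_triv_right)
  moreover have "Factorial_Ring.prime (7 :: nat)"
    by simp
  ultimately show "\<exists>i. card (circulations n) = 7 ^ i"
    using divides_primepow_nat by blast
qed

section \<open>Twisted graphs\<close>

text \<open>The candidates for row \<open>v\<close> of a flow; antisymmetry, which relates different
  rows, is left to \<open>compatible\<close>.\<close>

definition local_sols :: "nat \<Rightarrow> (nat \<Rightarrow> 7) \<Rightarrow> nat \<Rightarrow> (nat \<Rightarrow> 7) set" where
  "local_sols n b v = {x. x v = 0 \<and> (\<forall>w\<ge>n. x w = 0) \<and> (\<Sum>w<n. x w) = b v}"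

text \<open>On local solutions this is equality if \<open>u = v\<close>, since diagonal entries
  vanish, and antisymmetry on the edge between \<open>u\<close> and \<open>v\<close>
  otherwise.\<close>

definition compatible :: "nat \<Rightarrow> (nat \<Rightarrow> 7) \<Rightarrow> nat \<Rightarrow> (nat \<Rightarrow> 7) \<Rightarrow> bool" where
  "compatible u x v y \<longleftrightarrow> (u = v \<longrightarrow> x = y) \<and> x v + y u = 0"

text \<open>The 3-colourings of this graph encode the flows with net outflow \<open>b v\<close> at every vertex \<open>v\<close>:
  a vertex \<open>(v, t)\<close> is a ternary question about the row of the flow at \<open>v\<close>.\<close>

definition twisted_graph ::
    "nat \<Rightarrow> (nat \<Rightarrow> 7) \<Rightarrow> (unit, edge, nat \<times> ((nat \<Rightarrow> 7) \<Rightarrow> nat)) relstruct" where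
  "twisted_graph n b =
     \<lparr>sort_dom = (\<lambda>_. SIGMA v:{..<n}. local_sols n b v \<rightarrow>\<^sub>E colours),
      interp = (\<lambda>_. {[(u, t), (v, s)] |u t v s. u < n \<and> v < n \<and>
        t \<in> local_sols n b u \<rightarrow>\<^sub>E colours \<and> s \<in> local_sols n b v \<rightarrow>\<^sub>E colours \<and>
        (\<forall>x\<in>local_sols n b u. \<forall>y\<in>local_sols n b v. compatible u x v y \<longrightarrow> t x \<noteq> s y)})\<rparr>"

text \<open>Adding \<open>y v\<close> turns a row of outflow \<open>0\<close> into one with the
  outflow of \<open>y\<close> at \<open>v\<close>. Questions are pulled back along this translation,
  hence from a twisted graph to the untwisted one.\<close>

definition shift :: "nat \<Rightarrow> (nat \<Rightarrow> nat \<Rightarrow> 7) \<Rightarrow> nat \<times> ((nat \<Rightarrow> 7) \<Rightarrow> nat) \<Rightarrow> nat \<times> ((nat \<Rightarrow> 7) \<Rightarrow> nat)" where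
  "shift n y = (\<lambda>(v, t). (v, \<lambda>x\<in>local_sols n 0 v. t (x + y v)))"

lemma twisted_graph_dom:
  "(v, t) \<in> sort_dom (twisted_graph n b) s \<longleftrightarrow> v < n \<and> t \<in> local_sols n b v \<rightarrow>\<^sub>E colours"
  by (simp add: twisted_graph_def)

lemma finite_local_sols: "finite (local_sols n b v)"
proof (rule finite_subset)
  show "local_sols n b v \<subseteq> {f. (\<forall>x\<in>{..<n}. f x \<in> (UNIV :: 7 set)) \<and> (\<forall>x. x \<notin> {..<n} \<longrightarrow> f x = 0)}"
    by (auto simp: local_sols_def)
  show "finite {f. (\<forall>x\<in>{..<n}. f x \<in> (UNIV :: 7 set)) \<and> (\<forall>x. x \<notin> {..<n} \<longrightarrow> f x = 0)}"
    by (rule finite_card_supported_functions(1)) (rule finite_lessThan, rule finite)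
qed

lemma finite_twisted_graph: "finite (sort_dom (twisted_graph n b) s)"
proof -
  have "finite (local_sols n b v \<rightarrow>\<^sub>E colours)" for v
    by (rule finite_PiE[OF finite_local_sols]) simp
  then show ?thesis
    by (simp add: twisted_graph_def)
qed

lemma vocabulary_graph: "vocabulary graph_vocab"
proof -
  have "finite (UNIV :: edge set)"
    by (rule finite_subset[of _ "{Edge}"]) (auto intro: edge.exhaust)
  then show ?thesis
    by (simp add: vocabulary_def graph_vocab_def)
qed

lemma finite_structure_twisted_graph: "finite_structure graph_vocab (twisted_graph n b)"
  unfolding finite_structure_def
proof (intro conjI vocabulary_graph ballI)
  show "list_all2 (\<lambda>x s. x \<in> sort_dom (twisted_graph n b) s) xs (arity graph_vocab R)"
    if "xs \<in> interp (twisted_graph n b) R" for R xs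
    using that by (auto simp: twisted_graph_def graph_vocab_def)
qed (simp_all add: finite_twisted_graph)

section \<open>Shifts along flows\<close>

lemma add_flow_local_sols:
  assumes "flow n y" "(\<Sum>w<n. y v w) = b v" "x \<in> local_sols n 0 v"
  shows "x + y v \<in> local_sols n b v"
  using assms(2,3) flow_diagonal[OF assms(1), of v] flow_support[OF assms(1)]
  by (auto simp: local_sols_def sum.distrib)

lemma shift_dom:
  assumes "flow n y" "(\<Sum>w<n. y v w) = b v" "(v, t) \<in> sort_dom (twisted_graph n b) s"
  shows "shift n y (v, t) \<in> sort_dom (twisted_graph n 0) s'"
  using assms add_flow_local_sols[of n y v b, OF assms(1,2)]
  by (auto simp: shift_def twisted_graph_dom PiE_iff)

text \<open>Antisymmetry of \<open>y\<close> makes its contributions cancel in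
  \<open>compatible\<close>. The outflow of \<open>y\<close> matters only at the vertices occurring
  in \<open>xs\<close>, so shifts may exist locally even if no flow has outflow \<open>b\<close>
  everywhere.\<close>

lemma shift_interp:
  assumes y: "flow n y" and sums: "\<And>v t. (v, t) \<in> set xs \<Longrightarrow> (\<Sum>w<n. y v w) = b v"
    and xs: "xs \<in> interp (twisted_graph n b) R"
  shows "map (shift n y) xs \<in> interp (twisted_graph n 0) R'"
proof -
  obtain u t v s where uv: "xs = [(u, t), (v, s)]" "u < n" "v < n"
    "t \<in> local_sols n b u \<rightarrow>\<^sub>E colours" "s \<in> local_sols n b v \<rightarrow>\<^sub>E colours"
    and ne: "\<forall>x\<in>local_sols n b u. \<forall>y\<in>local_sols n b v. compatible u x v y \<longrightarrow> t x \<noteq> s y"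
    using xs by (auto simp: twisted_graph_def)
  have su: "(\<Sum>w<n. y u w) = b u" and sv: "(\<Sum>w<n. y v w) = b v"
    using sums by (auto simp: uv(1))
  note in_u = add_flow_local_sols[of n y u b, OF y su]
    and in_v = add_flow_local_sols[of n y v b, OF y sv]
  have "t (x + y u) \<noteq> s (x' + y v)"
    if "x \<in> local_sols n 0 u" "x' \<in> local_sols n 0 v" "compatible u x v x'" for x x'
  proof -
    have "y u v = - y v u"
      using y by (rule flow_antisym)
    then have "compatible u (x + y u) v (x' + y v)"
      using that(3) by (auto simp: compatible_def)
    then show ?thesis
      using ne in_u[OF that(1)] in_v[OF that(2)] by blast
  qed
  moreover have "(\<lambda>x\<in>local_sols n 0 u. t (x + y u)) \<in> local_sols n 0 u \<rightarrow>\<^sub>E colours"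
    "(\<lambda>x\<in>local_sols n 0 v. s (x + y v)) \<in> local_sols n 0 v \<rightarrow>\<^sub>E colours"
    using uv(4,5) in_u in_v by (auto simp: PiE_iff)
  ultimately show ?thesis
    using uv(2,3) by (simp add: twisted_graph_def uv(1) shift_def)
qed

text \<open>As \<open>z\<close> is a circulation, adding \<open>z v\<close> keeps a row in
  \<open>local_sols n 0 v\<close>, where the inner shift is given by its formula.\<close>

lemma shift_shift:
  assumes "z \<in> circulations n" "v < n"
  shows "shift n z (shift n y (v, t)) = shift n (z + y) (v, t)"
  using assms add_flow_local_sols[of n z v 0]
  by (auto simp: shift_def circulations_def fun_eq_iff add.assoc)

section \<open>Colourability of twisted graphs\<close>

lemma K3_edge_iff: "[a, b] \<in> interp K3 R \<longleftrightarrow> a \<in> colours \<and> b \<in> colours \<and> a \<noteq> b"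
  by (simp add: K3_def)

text \<open>Every question is answered according to the zero flow, whose rows are pairwise
  compatible.\<close>

lemma untwisted_colourable: "homomorphism graph_vocab (\<lambda>(v, t). t 0) (twisted_graph n 0) K3"
proof -
  have zero: "0 \<in> local_sols n 0 v" for v
    by (simp add: local_sols_def)
  have comp: "compatible u 0 v 0" for u v
    by (simp add: compatible_def)
  show ?thesis
    unfolding homomorphism_def
  proof (intro conjI ballI image_subsetI)
    fix s p
    assume "p \<in> sort_dom (twisted_graph n 0) s"
    then show "(\<lambda>(v, t). t 0) p \<in> sort_dom K3 s"
      using PiE_mem[OF _ zero] by (fastforce simp: twisted_graph_def K3_def)
  next
    fix R xs
    assume "xs \<in> interp (twisted_graph n 0) R"
    then obtain u t v s where uv: "xs = [(u, t), (v, s)]"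
      "t \<in> local_sols n 0 u \<rightarrow>\<^sub>E colours" "s \<in> local_sols n 0 v \<rightarrow>\<^sub>E colours"
      and ne: "\<forall>x\<in>local_sols n 0 u. \<forall>y\<in>local_sols n 0 v. compatible u x v y \<longrightarrow> t x \<noteq> s y"
      by (auto simp: twisted_graph_def)
    have "t 0 \<noteq> s 0"
      using ne zero comp by blast
    then show "map (\<lambda>(v, t). t 0) xs \<in> interp K3 R"
      using PiE_mem[OF uv(2) zero] PiE_mem[OF uv(3) zero]
      by (simp add: uv(1) K3_edge_iff del: insert_iff)
  qed
qed

lemma twisted_graph_edge:
  assumes "(u, t) \<in> sort_dom (twisted_graph n b) ()" "(v, s) \<in> sort_dom (twisted_graph n b) ()"
    and "\<And>x y. x \<in> local_sols n b u \<Longrightarrow> y \<in> local_sols n b v \<Longrightarrow> compatible u x v y \<Longrightarrow> t x \<noteq> s y"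
  shows "[(u, t), (v, s)] \<in> interp (twisted_graph n b) R"
  using assms by (auto simp: twisted_graph_def)

text \<open>The fibre over \<open>v\<close> is a power of the triangle, so up to a renaming of
  colours the colouring evaluates questions at one row \<open>\<xi> v\<close>. Edges between fibres
  make these rows antisymmetric, so the outflows add up to \<open>0\<close>.\<close>

lemma colouring_gives_flow:
  assumes "homomorphism graph_vocab h (twisted_graph n b) K3" and "0 < n"
  shows "(\<Sum>v<n. b v) = 0"
proof -
  let ?D = "sort_dom (twisted_graph n b) ()"
  have h_edge: "h (u, t) \<noteq> h (v, s)"
    if "[(u, t), (v, s)] \<in> interp (twisted_graph n b) Edge" for u t v s
    using assms(1) that K3_edge_iff by (force simp: homomorphism_def graph_vocab_def)
  have h_col: "h p \<in> colours" if "p \<in> ?D" for p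
    using assms(1) that by (auto simp: homomorphism_def graph_vocab_def K3_def)
  define k where "k v a = (v, \<lambda>x\<in>local_sols n b v. a)" for v and a :: nat
  have k_D: "k v a \<in> ?D" if "v < n" "a \<in> colours" for v a
    using that by (auto simp: k_def twisted_graph_dom)
  define \<sigma> where "\<sigma> a = h (k 0 a)" for a
  \<comment> \<open>Constant questions with different colours are adjacent even at different
    vertices, so one permutation \<open>\<sigma>\<close> describes \<open>h\<close> on the constants
    of all fibres.\<close>
  have k_ne: "h (k u a) \<noteq> h (k v c)" if "u < n" "v < n" "a \<in> colours" "c \<in> colours" "a \<noteq> c" for u v a c
    using k_D[OF that(1,3)] k_D[OF that(2,4)] that(5)
    unfolding k_def by (intro h_edge twisted_graph_edge) auto
  have \<sigma>_col: "\<sigma> a \<in> colours" if "a \<in> colours" for a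
    using k_D[OF \<open>0 < n\<close> that] h_col by (simp add: \<sigma>_def)
  have inj: "inj_on \<sigma> colours"
    using k_ne[OF \<open>0 < n\<close> \<open>0 < n\<close>] by (force simp: inj_on_def \<sigma>_def)
  have surj: "\<sigma> ` colours = colours"
    using inj \<sigma>_col by (intro card_subset_eq) (auto simp: card_image)
  have k_\<sigma>: "h (k v a) = \<sigma> a" if va: "v < n" "a \<in> colours" for v a
  proof -
    obtain c where c: "c \<in> colours" "h (k v a) = \<sigma> c"
      using h_col[OF k_D[OF va]] surj by (metis imageE)
    have "a = c"
      using k_ne[OF va(1) \<open>0 < n\<close> va(2) c(1)] c(2) unfolding \<sigma>_def by blast
    then show ?thesis
      using c(2) by simp
  qed
  define g where "g p = inv_into colours \<sigma> (h p)" for p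
  have g_col: "g p \<in> colours" if "p \<in> ?D" for p
    unfolding g_def by (rule inv_into_into) (use h_col[OF that] surj in blast)
  have g_edge: "g (u, t) \<noteq> g (v, s)"
    if "[(u, t), (v, s)] \<in> interp (twisted_graph n b) Edge" "(u, t) \<in> ?D" "(v, s) \<in> ?D" for u t v s
    using h_edge[OF that(1)] h_col[OF that(2)] h_col[OF that(3)] surj
    by (metis g_def inv_into_injective)
  have "\<exists>x\<in>local_sols n b v. \<forall>t\<in>local_sols n b v \<rightarrow>\<^sub>E colours. g (v, t) = t x" if "v < n" for v
  proof (rule idempotent_colouring_dictator[OF finite_local_sols])
    show "g (v, t) \<in> colours" if "t \<in> local_sols n b v \<rightarrow>\<^sub>E colours" for t
      using that \<open>v < n\<close> by (intro g_col) (simp add: twisted_graph_dom)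
    show "g (v, t) \<noteq> g (v, s)"
      if "t \<in> local_sols n b v \<rightarrow>\<^sub>E colours" "s \<in> local_sols n b v \<rightarrow>\<^sub>E colours"
        "\<forall>x\<in>local_sols n b v. t x \<noteq> s x" for t s
      using that \<open>v < n\<close>
      by (intro g_edge twisted_graph_edge) (auto simp: twisted_graph_dom compatible_def)
    show "g (v, \<lambda>x\<in>local_sols n b v. a) = a" if "a \<in> colours" for a
      using k_\<sigma>[OF \<open>v < n\<close> that] inj that by (simp add: g_def k_def inv_into_f_f)
  qed
  then obtain \<xi> where \<xi>: "\<And>v. v < n \<Longrightarrow> \<xi> v \<in> local_sols n b v"
    "\<And>v t. v < n \<Longrightarrow> t \<in> local_sols n b v \<rightarrow>\<^sub>E colours \<Longrightarrow> g (v, t) = t (\<xi> v)"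
    by metis
  have anti: "\<xi> u v = - \<xi> v u" if "u < n" "v < n" for u v
  proof (cases "u = v")
    case True
    then show ?thesis
      using \<xi>(1)[OF that(1)] by (simp add: local_sols_def)
  next
    case False
    \<comment> \<open>\<open>t\<close> asks whether entry \<open>v\<close> of the row at
      \<open>u\<close> is \<open>\<xi> u v\<close>, and \<open>s\<close> whether entry
      \<open>u\<close> of the row at \<open>v\<close> is its negative, with the two colours swapped.
      Compatible rows answer alike, so the questions are adjacent.\<close>
    define t where "t = (\<lambda>x\<in>local_sols n b u. if x v = \<xi> u v then 0 else (1::nat))"
    define s where "s = (\<lambda>y\<in>local_sols n b v. if y u = - \<xi> u v then 1 else (0::nat))"
    have ts: "t \<in> local_sols n b u \<rightarrow>\<^sub>E colours" "s \<in> local_sols n b v \<rightarrow>\<^sub>E colours"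
      by (auto simp: t_def s_def)
    then have "[(u, t), (v, s)] \<in> interp (twisted_graph n b) Edge"
      using that by (intro twisted_graph_edge)
        (auto simp: twisted_graph_dom compatible_def t_def s_def add_eq_0_iff)
    then have "t (\<xi> u) \<noteq> s (\<xi> v)"
      using g_edge \<xi>(2) ts that by (simp add: twisted_graph_dom)
    then show ?thesis
      using \<xi>(1) that by (auto simp: t_def s_def split: if_splits)
  qed
  have "(\<Sum>v<n. b v) = (\<Sum>v<n. \<Sum>w<n. \<xi> v w)"
    using \<xi>(1) by (intro sum.cong) (auto simp: local_sols_def)
  then show ?thesis
    using antisymmetric_total[of n \<xi>, OF anti] by simp
qed

section \<open>The counterexample\<close>

lemma reduct_typed:
  assumes "xs \<in> interp (reduct W \<phi> d \<rho> B) R" "vocabulary W" "x \<in> set xs"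
  shows "x \<in> sort_dom (reduct W \<phi> d \<rho> B) (d (fst x))"
proof -
  obtain Q as where Q: "Q \<in> symbols W" "xs = zip (arity W Q) as"
    "list_all2 (\<lambda>t a. a \<in> datalog_output (sort_prog \<phi> t) B) (arity W Q) as"
    using assms(1) by (rule reduct_interpE)
  have "fst x \<in> set (arity W Q)"
    using assms(3) Q(2) by (metis prod.collapse set_zip_leftD)
  moreover have "snd x \<in> datalog_output (sort_prog \<phi> (fst x)) B"
  proof -
    have "\<forall>p\<in>set xs. snd p \<in> datalog_output (sort_prog \<phi> (fst p)) B"
      using Q(3) by (simp add: Q(2) list_all2_iff case_prod_beta)
    then show ?thesis
      using assms(3) by blast
  qed
  ultimately show ?thesis
    using assms(2) Q(1) by (auto simp: reduct_dom_iff vocabulary_def)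
qed

text \<open>The reduction speaks of instances over \<open>nat\<close> only. A copy \<open>C\<close>
  of \<open>B\<close> over \<open>nat\<close> has homomorphisms to and from \<open>B\<close>, and
  \<open>reduct_hom\<close> carries these over to the reducts.\<close>

lemma reduct_hom_iff:
  fixes B :: "('s, 'r, 'a) relstruct"
  assumes red: "\<And>B :: ('s, 'r, nat) relstruct. finite_structure V1 B \<Longrightarrow>
      finite_structure V2 (reduct W \<phi> d \<rho> B) \<and> (B \<in> CSP V1 A1 \<longleftrightarrow> reduct W \<phi> d \<rho> B \<in> CSP V2 A2)"
    and W: "vocabulary W" and B: "finite_structure V1 B"
    and UNIV: "sorts V1 = UNIV" "symbols V1 = UNIV"
  shows "(\<exists>h. homomorphism V1 h B A1) \<longleftrightarrow> (\<exists>h. homomorphism V2 h (reduct W \<phi> d \<rho> B) A2)"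
proof -
  let ?U = "\<Union>s. sort_dom B s"
  have "finite ?U"
    using B by (auto simp: finite_structure_def vocabulary_def UNIV)
  then obtain e :: "'a \<Rightarrow> nat" where e: "inj_on e ?U"
    using finite_imp_inj_to_nat_seg by metis
  define i where "i = inv_into ?U e"
  define C where "C = \<lparr>sort_dom = (\<lambda>s. e ` sort_dom B s), interp = (\<lambda>R. map e ` interp B R)\<rparr>"
  have i_e: "i (e x) = x" if "x \<in> sort_dom B s" for x s
    unfolding i_def using that by (intro inv_into_f_f[OF e]) auto
  have typed: "list_all2 (\<lambda>x s. x \<in> sort_dom B s) xs (arity V1 R)" if "xs \<in> interp B R" for xs R
    using B that by (auto simp: finite_structure_def UNIV)
  have map_i_e: "map i (map e xs) = xs" if "xs \<in> interp B R" for xs R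
  proof -
    have "\<exists>s. x \<in> sort_dom B s" if "x \<in> set xs" for x
      using typed[OF \<open>xs \<in> interp B R\<close>] that by (auto simp: list_all2_conv_all_nth in_set_conv_nth)
    then have "i (e x) = x" if "x \<in> set xs" for x
      using that i_e by blast
    then show ?thesis
      by (simp add: map_idI)
  qed
  have disj: "e ` sort_dom B s \<inter> e ` sort_dom B t = {}" if "s \<noteq> t" for s t
  proof -
    have "sort_dom B s \<inter> sort_dom B t = {}"
      using B that by (auto simp: finite_structure_def UNIV)
    then show ?thesis
      using inj_on_image_Int[OF e, of "sort_dom B s" "sort_dom B t"] by (simp add: UN_upper)
  qed
  have C: "finite_structure V1 C"
    unfolding finite_structure_def
  proof (intro conjI ballI impI)
    show "vocabulary V1" "finite (sort_dom C s)" for s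
      using B by (auto simp: finite_structure_def UNIV C_def)
    show "sort_dom C s \<inter> sort_dom C t = {}" if "s \<noteq> t" for s t
      using disj[OF that] by (simp add: C_def)
    show "list_all2 (\<lambda>x s. x \<in> sort_dom C s) ys (arity V1 R)" if ys: "ys \<in> interp C R" for ys R
    proof -
      obtain xs where xs: "xs \<in> interp B R" "ys = map e xs"
        using ys by (auto simp: C_def)
      show ?thesis
        unfolding xs(2) list_all2_map1 C_def
        by (rule list_all2_mono[OF typed[OF xs(1)]]) simp
    qed
  qed
  have e_dom: "e x \<in> sort_dom C s" if "x \<in> sort_dom B s" for x s
    using that by (simp add: C_def)
  have e_rel: "map e xs \<in> interp C R" if "xs \<in> interp B R" for xs R
    using that by (simp add: C_def)
  have i_dom: "i y \<in> sort_dom B s" if "y \<in> sort_dom C s" for y s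
    using that i_e by (auto simp: C_def)
  have i_rel: "map i ys \<in> interp B R" if "ys \<in> interp C R" for ys R
    using that map_i_e by (auto simp: C_def simp del: map_map)
  have "(\<exists>h. homomorphism V1 h B A1) \<longleftrightarrow> (\<exists>h. homomorphism V1 h C A1)"
  proof
    assume "\<exists>h. homomorphism V1 h B A1"
    moreover have "homomorphism V1 i C B"
      using i_dom i_rel by (auto simp: homomorphism_def)
    ultimately show "\<exists>h. homomorphism V1 h C A1"
      using homomorphism_comp by blast
  next
    assume "\<exists>h. homomorphism V1 h C A1"
    moreover have "homomorphism V1 e B C"
      using e_dom e_rel by (auto simp: homomorphism_def)
    ultimately show "\<exists>h. homomorphism V1 h B A1"
      using homomorphism_comp by blast
  qed
  also have "\<dots> \<longleftrightarrow> (\<exists>h. homomorphism V2 h (reduct W \<phi> d \<rho> C) A2)"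
    using red[OF C] C by (simp add: CSP_def)
  also have "\<dots> \<longleftrightarrow> (\<exists>h. homomorphism V2 h (reduct W \<phi> d \<rho> B) A2)"
  proof
    assume "\<exists>h. homomorphism V2 h (reduct W \<phi> d \<rho> C) A2"
    then show "\<exists>h. homomorphism V2 h (reduct W \<phi> d \<rho> B) A2"
      using homomorphism_comp[OF reduct_hom[OF e_dom e_rel W]] by blast
  next
    assume "\<exists>h. homomorphism V2 h (reduct W \<phi> d \<rho> B) A2"
    then show "\<exists>h. homomorphism V2 h (reduct W \<phi> d \<rho> C) A2"
      using homomorphism_comp[OF reduct_hom[OF i_dom i_rel W]] by blast
  qed
  finally show ?thesis .
qed

text \<open>The outflow is prescribed only at the vertices below \<open>U\<close>; prescribing it at
  all \<open>n\<close> vertices would force \<open>b\<close> to have total \<open>0\<close>.\<close>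

definition twist_maps ::
    "nat \<Rightarrow> (nat \<Rightarrow> 7) \<Rightarrow> (nat \<times> ((nat \<Rightarrow> 7) \<Rightarrow> nat)) set \<Rightarrow>
     (nat \<times> ((nat \<Rightarrow> 7) \<Rightarrow> nat) \<Rightarrow> nat \<times> ((nat \<Rightarrow> 7) \<Rightarrow> nat)) set" where
  "twist_maps n b U = {shift n y |y. flow n y \<and> (\<forall>v\<in>fst ` U. (\<Sum>w<n. y v w) = b v)}"

lemma twisted_graph_dom_fst: "p \<in> (\<Union>s. sort_dom (twisted_graph n b) s) \<Longrightarrow> fst p < n"
  by (auto simp: twisted_graph_def)

lemma shift_cong: "y (fst p) = y' (fst p) \<Longrightarrow> shift n y p = shift n y' p"
  by (auto simp: shift_def split: prod.splits)

lemma unused_vertex: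
  assumes "finite U" "card U < n"
  shows "\<exists>r<n. r \<notin> fst ` U"
proof (rule ccontr)
  assume "\<not> ?thesis"
  then have "{..<n} \<subseteq> fst ` U"
    by auto
  then have "n \<le> card (fst ` U)"
    using card_mono[OF finite_imageI[OF assms(1)]] by fastforce
  then show False
    using card_image_le[OF assms(1), of fst] assms(2) by linarith
qed

text \<open>Among \<open>Suc k\<close> vertices, \<open>k\<close> elements always leave some
  \<open>r\<close> free, and an extended flow routes all defects to it.\<close>

lemma partial_maps_twist: "partial_maps k (twisted_graph (Suc k) b) (twisted_graph (Suc k) 0) (twist_maps (Suc k) b)"
proof
  fix f U Z
  assume f: "f \<in> twist_maps (Suc k) b U"
  show "f \<in> twist_maps (Suc k) b Z" if "Z \<subseteq> U"
    using f that by (auto simp: twist_maps_def)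
  assume Z: "U \<subseteq> Z" "finite Z" "card Z \<le> k" "Z \<subseteq> (\<Union>s. sort_dom (twisted_graph (Suc k) b) s)"
  obtain y where y: "f = shift (Suc k) y" "flow (Suc k) y"
    "\<And>v. v \<in> fst ` U \<Longrightarrow> (\<Sum>w<Suc k. y v w) = b v"
    using f unfolding twist_maps_def by blast
  obtain r where r: "r < Suc k" "r \<notin> fst ` Z"
    using unused_vertex[OF Z(2), of "Suc k"] Z(3) by auto
  then have "r \<notin> fst ` U"
    using Z(1) by auto
  then obtain y' where y': "flow (Suc k) y'" "\<forall>v\<in>fst ` U. y' v = y v"
    "\<forall>v<Suc k. v \<noteq> r \<longrightarrow> (\<Sum>w<Suc k. y' v w) = b v"
    using flow_extend[OF y(2,3) r(1)] by blast
  have "(\<Sum>w<Suc k. y' v w) = b v" if "v \<in> fst ` Z" for v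
    using that y'(3) r(2) Z(4) twisted_graph_dom_fst by blast
  then have "shift (Suc k) y' \<in> twist_maps (Suc k) b Z"
    using y'(1) unfolding twist_maps_def by blast
  moreover have "\<forall>p\<in>U. shift (Suc k) y' p = f p"
    using y'(2) by (auto simp: y(1) intro!: shift_cong)
  ultimately show "\<exists>f'\<in>twist_maps (Suc k) b Z. \<forall>p\<in>U. f' p = f p"
    by blast
next
  fix f U p s
  assume f: "f \<in> twist_maps (Suc k) b U" and p: "p \<in> U" "p \<in> sort_dom (twisted_graph (Suc k) b) s"
  obtain v t where vt: "p = (v, t)"
    by fastforce
  obtain y where y: "f = shift (Suc k) y" "flow (Suc k) y"
    "\<And>v. v \<in> fst ` U \<Longrightarrow> (\<Sum>w<Suc k. y v w) = b v"
    using f unfolding twist_maps_def by blast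
  have "(\<Sum>w<Suc k. y v w) = b v"
    using p(1) by (intro y(3)) (force simp: vt)
  then show "f p \<in> sort_dom (twisted_graph (Suc k) 0) s"
    using p(2) unfolding y(1) vt by (rule shift_dom[of _ _ _ b, OF y(2)])
next
  fix f U xs R
  assume f: "f \<in> twist_maps (Suc k) b U" and xs: "xs \<in> interp (twisted_graph (Suc k) b) R" "set xs \<subseteq> U"
  obtain y where y: "f = shift (Suc k) y" "flow (Suc k) y"
    "\<And>v. v \<in> fst ` U \<Longrightarrow> (\<Sum>w<Suc k. y v w) = b v"
    using f unfolding twist_maps_def by blast
  show "map f xs \<in> interp (twisted_graph (Suc k) 0) R"
    unfolding y(1)
  proof (rule shift_interp[OF y(2) _ xs(1)])
    show "(\<Sum>w<Suc k. y v w) = b v" if "(v, t) \<in> set xs" for v t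
      using that xs(2) by (intro y(3)) force
  qed
qed

text \<open>The difference of the two flows has outflow \<open>0\<close> at the vertices below
  \<open>U\<close>, and a free vertex \<open>r\<close> allows extending it to a circulation.\<close>

lemma twist_maps_unique:
  assumes f: "f \<in> twist_maps n b U" "f' \<in> twist_maps n b U"
    and U: "finite U" "card U < n" "U \<subseteq> (\<Union>s. sort_dom (twisted_graph n b) s)"
  shows "\<exists>g\<in>shift n ` circulations n. \<forall>p\<in>U. f' p = g (f p)"
proof -
  obtain y where y: "f = shift n y" "flow n y" "\<And>v. v \<in> fst ` U \<Longrightarrow> (\<Sum>w<n. y v w) = b v"
    using f(1) unfolding twist_maps_def by blast
  obtain y' where y': "f' = shift n y'" "flow n y'" "\<And>v. v \<in> fst ` U \<Longrightarrow> (\<Sum>w<n. y' v w) = b v"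
    using f(2) unfolding twist_maps_def by blast
  obtain r where r: "r < n" "r \<notin> fst ` U"
    using unused_vertex[OF U(1,2)] by blast
  have "(\<Sum>w<n. (y' - y) v w) = 0" if "v \<in> fst ` U" for v
    using y(3)[OF that] y'(3)[OF that] by (simp add: sum_subtractf)
  then obtain z where z: "flow n z" "\<forall>v\<in>fst ` U. z v = (y' - y) v"
    "\<forall>v<n. v \<noteq> r \<longrightarrow> (\<Sum>w<n. z v w) = 0"
    using flow_extend[OF flow_diff[OF y'(2) y(2)], of "fst ` U" "\<lambda>_. 0" r] r by auto
  \<comment> \<open>The extension does not control \<open>r\<close>, but all other rows have sum
    \<open>0\<close>, so the outflow at \<open>r\<close> is the total, which vanishes by
    antisymmetry.\<close>
  have "(\<Sum>w<n. z r w) = (\<Sum>v<n. if v = r then \<Sum>w<n. z r w else 0)"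
    using r(1) by simp
  also have "\<dots> = (\<Sum>v<n. \<Sum>w<n. z v w)"
    using z(3) by (intro sum.cong) auto
  also have "\<dots> = 0"
    by (rule antisymmetric_total) (rule flow_antisym[OF z(1)])
  finally have "z \<in> circulations n"
    using z(1,3) unfolding circulations_def by blast
  moreover have "f' p = shift n z (f p)" if p: "p \<in> U" for p
  proof -
    obtain v t where vt: "p = (v, t)"
      by fastforce
    then have "v < n" "z v = (y' - y) v"
      using p U(3) twisted_graph_dom_fst[of p n b] z(2) by force+
    then show ?thesis
      unfolding y(1) y'(1) vt shift_shift[OF \<open>z \<in> circulations n\<close> \<open>v < n\<close>]
      by (intro shift_cong) simp
  qed
  ultimately show ?thesis
    by blast
qed

lemma group_acting_circulations:
  fixes V :: "(unit, ((nat \<Rightarrow> int) set, (nat \<Rightarrow> int) set) or_symbol) vocab"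
  assumes W: "vocabulary W" and V: "sorts V = UNIV"
  shows "group_acting (circulations n) (\<lambda>z. tuple_map (shift n z)) V (reduct W \<phi> d \<rho> (twisted_graph n 0))"
proof
  let ?B = "twisted_graph n 0"
  show "homomorphism V (tuple_map (shift n z)) (reduct W \<phi> d \<rho> ?B) (reduct W \<phi> d \<rho> ?B)"
    if z: "z \<in> circulations n" for z
  proof (rule reduct_hom[OF _ _ W])
    have sum: "(\<Sum>w<n. z v w) = (0 :: nat \<Rightarrow> 7) v" if "v < n" for v
      using z that by (simp add: circulations_def)
    have flow: "flow n z"
      using z by (simp add: circulations_def)
    show "shift n z p \<in> sort_dom ?B s" if "p \<in> sort_dom ?B s" for p s
    proof (cases p)
      case (Pair v t)
      then have "v < n"
        using that by (simp add: twisted_graph_dom)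
      from shift_dom[of n z v 0, OF flow sum[OF this]] that show ?thesis
        unfolding Pair .
    qed
    show "map (shift n z) xs \<in> interp ?B R" if xs: "xs \<in> interp ?B R" for xs R
    proof (rule shift_interp[OF flow _ xs])
      show "(\<Sum>w<n. z v w) = (0 :: nat \<Rightarrow> 7) v" if "(v, t) \<in> set xs" for v t
        using that xs by (intro sum) (auto simp: twisted_graph_def)
    qed
  qed
  show "tuple_map (shift n z) (tuple_map (shift n z') x) = tuple_map (shift n (z + z')) x"
    if z: "z \<in> circulations n" "z' \<in> circulations n" and x: "x \<in> sort_dom (reduct W \<phi> d \<rho> ?B) ()"
    for z z' x
  proof -
    obtain k where "interp_width_le k W \<phi>"
      using interp_width_exists[OF W] by blast
    then have "fst p < n" if "p \<in> set (snd x)" for p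
      using reduct_dom_support(2)[OF x] that twisted_graph_dom_fst by blast
    then have "shift n z (shift n z' p) = shift n (z + z') p" if "p \<in> set (snd x)" for p
      using shift_shift[OF z(1), of "fst p" z' "snd p"] that by simp
    then show ?thesis
      by (cases x) (simp add: tuple_map_def)
  qed
  show "set xs \<subseteq> sort_dom (reduct W \<phi> d \<rho> ?B) ()" if "xs \<in> interp (reduct W \<phi> d \<rho> ?B) R" for R xs
    using reduct_typed[OF that W] by auto
qed (simp_all add: card_circulations circulations_zero circulations_add circulations_diff V)

theorem lemma5p3:
  shows "\<not> datalog_union_reducible graph_vocab K3
    (OR_T_vocab (coset_vocab (integer_mod_group 2) 3) (coset_vocab (integer_mod_group 3) 3))
    (OR_T (coset_vocab (integer_mod_group 2) 3) (coset_structure (integer_mod_group 2) 3)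
          (coset_vocab (integer_mod_group 3) 3) (coset_structure (integer_mod_group 3) 3))"
proof
  let ?V = "OR_T_vocab (coset_vocab (integer_mod_group 2) 3) (coset_vocab (integer_mod_group 3) 3)"
  let ?A = "OR_T (coset_vocab (integer_mod_group 2) 3) (coset_structure (integer_mod_group 2) 3)
    (coset_vocab (integer_mod_group 3) 3) (coset_structure (integer_mod_group 3) 3)"
  assume "datalog_union_reducible graph_vocab K3 ?V ?A"
  then obtain W :: "(nat, nat) vocab" and \<phi> d \<rho> where "datalog_interpretation graph_vocab W \<phi>"
    and reduction: "\<forall>B :: (unit, edge, nat) relstruct. finite_structure graph_vocab B \<longrightarrow>
      finite_structure ?V (reduct W \<phi> d \<rho> B) \<and>
      (B \<in> CSP graph_vocab K3 \<longleftrightarrow> reduct W \<phi> d \<rho> B \<in> CSP ?V ?A)"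
    unfolding datalog_union_reducible_def reduct_def[symmetric] by (elim exE conjE) (rule that)
  then have W: "vocabulary W"
    by (simp add: datalog_interpretation_def)
  note red = reduction[rule_format]
  have hom_iff: "(\<exists>h. homomorphism graph_vocab h (twisted_graph n b) K3) \<longleftrightarrow>
      (\<exists>h. homomorphism ?V h (reduct W \<phi> d \<rho> (twisted_graph n b)) ?A)" for n b
    using reduct_hom_iff[OF red W finite_structure_twisted_graph] by (simp add: graph_vocab_def)
  obtain k where k: "interp_width_le k W \<phi>"
    using interp_width_exists[OF W] by blast
  define n where "n = Suc k"
  \<comment> \<open>The total is \<open>1\<close>, which is nonzero modulo \<open>7\<close>, so no
    3-colouring exists.\<close>
  define b where "b v = (if v = 0 then 1 else 0 :: 7)" for v :: nat
  have sorts: "sorts ?V = UNIV"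
    by (simp add: OR_T_vocab_def)
  interpret group_acting "circulations n" "\<lambda>z. tuple_map (shift n z)" ?V
    "reduct W \<phi> d \<rho> (twisted_graph n 0)"
    by (rule group_acting_circulations[OF W sorts])
  obtain i where i: "card (circulations n) = 7 ^ i"
    using card_circulations(2) by blast
  \<comment> \<open>The choice of \<open>7\<close> enters here: it is a prime congruent to
    \<open>1\<close> modulo both \<open>2\<close> and \<open>3\<close>.\<close>
  have "(7 :: int) ^ i mod 2 = 1" "(7 :: int) ^ i mod 3 = 1"
    using power_mod[of "7 :: int" 2 i] power_mod[of "7 :: int" 3 i] by simp_all
  then have card: "int (card (circulations n)) mod int 2 = 1 mod int 2"
    "int (card (circulations n)) mod int 3 = 1 mod int 3"
    by (simp_all add: i)
  obtain h where h: "homomorphism ?V h (reduct W \<phi> d \<rho> (twisted_graph n 0)) ?A"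
    using hom_iff untwisted_colourable by blast
  obtain h' where h': "homomorphism ?V h' (reduct W \<phi> d \<rho> (twisted_graph n 0)) ?A"
    and inv: "\<And>x z. x \<in> sort_dom (reduct W \<phi> d \<rho> (twisted_graph n 0)) () \<Longrightarrow> z \<in> circulations n \<Longrightarrow>
      h' (tuple_map (shift n z) x) = h' x"
    using invariant_hom_to_OR_T[OF refl h _ _ _ card, simplified] by blast
  interpret partial_maps k "twisted_graph n b" "twisted_graph n 0" "twist_maps n b"
    unfolding n_def by (rule partial_maps_twist)
  have "\<exists>h. homomorphism ?V h (reduct W \<phi> d \<rho> (twisted_graph n b)) ?A"
  proof (rule reduct_hom_of_invariant[OF k W _ h' sorts, where \<Gamma> = "shift n ` circulations n"])
    show "twist_maps n b {} \<noteq> {}"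
      using flow_zero by (auto simp: twist_maps_def)
    show "h' (tuple_map g x) = h' x"
      if g: "g \<in> shift n ` circulations n" "x \<in> sort_dom (reduct W \<phi> d \<rho> (twisted_graph n 0)) s" for g x s
    proof -
      obtain z where "z \<in> circulations n" "g = shift n z"
        using g(1) by blast
      then show ?thesis
        using inv[of x z] g(2) by simp
    qed
    show "\<exists>g\<in>shift n ` circulations n. \<forall>x\<in>U. f' x = g (f x)"
      if "f \<in> twist_maps n b U" "f' \<in> twist_maps n b U" "finite U" "card U \<le> k"
        "U \<subseteq> (\<Union>s. sort_dom (twisted_graph n b) s)" for U f f'
      using twist_maps_unique[OF that(1-3) _ that(5)] that(4) by (simp add: n_def)
    show "\<forall>x\<in>set xs. \<exists>s. x \<in> sort_dom (reduct W \<phi> d \<rho> (twisted_graph n b)) s"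
      if "xs \<in> interp (reduct W \<phi> d \<rho> (twisted_graph n b)) R" for R xs
      using reduct_typed[OF that W] by blast
  qed
  then obtain c where "homomorphism graph_vocab c (twisted_graph n b) K3"
    using hom_iff by blast
  then have "(\<Sum>v<n. b v) = 0"
    by (rule colouring_gives_flow) (simp add: n_def)
  then show False
    by (simp add: b_def n_def del: sum.lessThan_Suc)
qed

end
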